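(* Let $(X,d)$ be a metric space that is a Polish space and let $m\ge1$. For any $\mu\in \mathcal{W}(X,\mathbb{R}^m)$, $$\sup\Big\{\int_X\langle u, d\mu \rangle \mid u\colon X\to\mathbb{R}^m \text{ is } 1\text{-Lipschitz}\Big\}=\|\mu\|_{\mathcal{W}(X,\mathbb{R}^m)}.$$ Moreover, there exists a $1$-Lipschitz function $u_0\colon X\to\mathbb{R}^m$ such that $$\sup\Big\{\int_X\langle u, d\mu \rangle \mid u\colon X\to\mathbb{R}^m \text{ is } 1\text{-Lipschitz}\Big\}=\int_X\langle u_0, d\mu\rangle.$$
   Context: $\mathbb{R}^m$ carries the Euclidean norm $\|\cdot\|$ and the standard scalar product $\langle\cdot,\cdot\rangle$. For an $\mathbb{R}^m$-valued Borel measure $\mu$, $\|\mu\|$ denotes its total variation measure, and $\int\langle u,d\mu\rangle=\sum_{i=1}^m\int u_i\,d\mu_i$. For an $\mathbb{R}^m$-valued Borel measure $\pi$ on $X\times X$, its marginals are $\mathrm{P}_1\pi(A)=\pi(A\times X)$ and $\mathrm{P}_2\pi(A)=\pi(X\times A)$ for Borel $A\subset X$. $\Gamma(\mu)$ is the set of all $\mathbb{R}^m$-valued Borel measures $\pi$ on $X\times X$ with $\mathrm{P}_1\pi-\mathrm{P}_2\pi=\mu$. The Wasserstein space $\mathcal{W}(X,\mathbb{R}^m)$ is the space of all $\mathbb{R}^m$-valued Borel measures $\mu$ on $X$ with $\mu(X)=0$ and $\int_X d(x,x_0)\,d\|\mu\|(x)<\infty$ for some $x_0\in X$, with the norm $$\|\mu\|_{\mathcal{W}(X,\mathbb{R}^m)}=\inf\Big\{\int_{X\times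 X}d(x,y)\,d\|\pi\|(x,y)\mid \pi\in\Gamma(\mu)\Big\}.$$ *)

theory Defs
  imports "HOL-Analysis.Analysis"
begin

text \<open>
  Vector measures are set functions on the \<sigma>-algebra of a measurable space; only the values on
  measurable sets are relevant.
\<close>

definition vector_measure ::
    "'a measure \<Rightarrow> ('a set \<Rightarrow> 'b::real_normed_vector) \<Rightarrow> bool" where
  "vector_measure M \<mu> \<longleftrightarrow>
     (\<forall>A :: nat \<Rightarrow> 'a set. range A \<subseteq> sets M \<longrightarrow> disjoint_family A \<longrightarrow>
        (\<lambda>n. \<mu> (A n)) sums \<mu> (\<Union>n. A n))"

text \<open>
  The supremum of \<open>\<Sum>n. \<parallel>\<mu> (F n)\<parallel>\<close> over all countable measurable partitions \<open>F\<close>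
  of \<open>A\<close>.  For a vector measure this set function is countably additive, so that
  \<^const>\<open>measure_of\<close> does not degenerate; see \<open>emeasure_total_variation\<close> below.
\<close>

definition total_variation ::
    "'a measure \<Rightarrow> ('a set \<Rightarrow> 'b::real_normed_vector) \<Rightarrow> 'a measure" where
  "total_variation M \<mu> = measure_of (space M) (sets M)
     (\<lambda>A. SUP F \<in> {F :: nat \<Rightarrow> 'a set. range F \<subseteq> sets M \<and> disjoint_family F \<and> (\<Union>n. F n) = A}.
        \<Sum>n. ennreal (norm (\<mu> (F n))))"

text \<open>
  The positive part \<open>\<nu>\<^sup>+\<close> of the Jordan decomposition of a finite signed measure \<open>\<nu>\<close>:
  \<open>\<nu>\<^sup>+(A)\<close> is the supremum of \<open>\<nu>(B)\<close> over measurable \<open>B \<subseteq> A\<close>.  (Negative values of \<open>\<nu>(B)\<close>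
  are cut off by \<^const>\<open>ennreal\<close>, which is harmless because of \<open>B = {}\<close>.)  The negative part
  is the positive part of \<open>-\<nu>\<close>.
\<close>

definition positive_variation :: "'a measure \<Rightarrow> ('a set \<Rightarrow> real) \<Rightarrow> 'a measure" where
  "positive_variation M \<nu> = measure_of (space M) (sets M)
     (\<lambda>A. SUP B \<in> {B \<in> sets M. B \<subseteq> A}. ennreal (\<nu> B))"

definition signed_integral :: "'a measure \<Rightarrow> ('a set \<Rightarrow> real) \<Rightarrow> ('a \<Rightarrow> real) \<Rightarrow> real" where
  "signed_integral M \<nu> f =
     integral\<^sup>L (positive_variation M \<nu>) f - integral\<^sup>L (positive_variation M (\<lambda>A. - \<nu> A)) f"

definition inner_integral ::
    "'a measure \<Rightarrow> ('a set \<Rightarrow> real ^ 'm) \<Rightarrow> ('a \<Rightarrow> real ^ 'm) \<Rightarrow> real" where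
  "inner_integral M \<mu> u = (\<Sum>i\<in>UNIV. signed_integral M (\<lambda>A. \<mu> A $ i) (\<lambda>x. u x $ i))"

definition marginal1 :: "(('a \<times> 'a) set \<Rightarrow> 'b) \<Rightarrow> 'a set \<Rightarrow> 'b" where
  "marginal1 \<pi> A = \<pi> (A \<times> UNIV)"

definition marginal2 :: "(('a \<times> 'a) set \<Rightarrow> 'b) \<Rightarrow> 'a set \<Rightarrow> 'b" where
  "marginal2 \<pi> A = \<pi> (UNIV \<times> A)"

definition transports ::
    "('a::metric_space set \<Rightarrow> real ^ 'm) \<Rightarrow> (('a \<times> 'a) set \<Rightarrow> real ^ 'm) set" where
  "transports \<mu> = {\<pi>. vector_measure borel \<pi> \<and>
     (\<forall>A \<in> sets borel. marginal1 \<pi> A - marginal2 \<pi> A = \<mu> A)}"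

definition wasserstein_space :: "('a::metric_space set \<Rightarrow> real ^ 'm) set" where
  "wasserstein_space = {\<mu>. vector_measure borel \<mu> \<and> \<mu> UNIV = 0 \<and>
     (\<exists>x0. (\<integral>\<^sup>+ x. ennreal (dist x x0) \<partial>total_variation borel \<mu>) < \<infinity>)}"

definition wasserstein_norm :: "('a::metric_space set \<Rightarrow> real ^ 'm) \<Rightarrow> ennreal" where
  "wasserstein_norm \<mu> = (INF \<pi> \<in> transports \<mu>.
     \<integral>\<^sup>+ z. ennreal (dist (fst z) (snd z)) \<partial>total_variation borel \<pi>)"


lemma vector_measure_empty:
  assumes "vector_measure M \<mu>"
  shows "\<mu> {} = 0"
proof -
  have "(\<lambda>n::nat. \<mu> {}) sums \<mu> (\<Union>n::nat. {})"
    using assms unfolding vector_measure_def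
    by (elim allE[of _ "\<lambda>_. {}"]) (auto simp: disjoint_family_on_def)
  then have "summable (\<lambda>n::nat. \<mu> {})" by (rule sums_summable)
  then show ?thesis by (simp add: summable_const_iff)
qed

lemma vector_measure_sums:
  assumes "vector_measure M \<mu>" "range A \<subseteq> sets M" "disjoint_family A"
  shows "(\<lambda>n. \<mu> (A n)) sums \<mu> (\<Union>n::nat. A n)"
  using assms unfolding vector_measure_def by blast

lemma vector_measure_Un:
  assumes "vector_measure M \<mu>" "A \<in> sets M" "B \<in> sets M" "A \<inter> B = {}"
  shows "\<mu> (A \<union> B) = \<mu> A + \<mu> B"
proof -
  have "range (binaryset A B) \<subseteq> sets M"
    using assms by (auto simp: range_binaryset_eq)
  moreover have "disjoint_family (binaryset A B)"
    using assms(4) by (auto simp: disjoint_family_on_def binaryset_def)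
  ultimately have "(\<lambda>n. \<mu> (binaryset A B n)) sums \<mu> (\<Union>n. binaryset A B n)"
    using vector_measure_sums[OF assms(1)] by blast
  moreover have "(\<lambda>n. \<mu> (binaryset A B n)) sums (\<mu> A + \<mu> B)"
    by (rule binaryset_sums) (rule vector_measure_empty[OF assms(1)])
  ultimately show ?thesis
    using sums_unique2 by (simp add: UN_binaryset_eq) blast
qed

lemma ennreal_norm_le_suminf:
  fixes f :: "nat \<Rightarrow> 'b::real_normed_vector"
  assumes "f sums s"
  shows "ennreal (norm s) \<le> (\<Sum>n. ennreal (norm (f n)))"
proof -
  have lim: "(\<lambda>n. ennreal (norm (\<Sum>i<n. f i))) \<longlonglongrightarrow> ennreal (norm s)"
    using assms unfolding sums_def by (intro tendsto_intros)
  have "ennreal (norm (\<Sum>i<n. f i)) \<le> (\<Sum>n. ennreal (norm (f n)))" for n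
  proof -
    have "ennreal (norm (\<Sum>i<n. f i)) \<le> ennreal (\<Sum>i<n. norm (f i))"
      by (intro ennreal_leI norm_sum)
    also have "\<dots> = (\<Sum>i<n. ennreal (norm (f i)))" by (rule sum_ennreal[symmetric]) simp
    also have "\<dots> \<le> (\<Sum>n. ennreal (norm (f n)))" by (rule sum_le_suminf) auto
    finally show ?thesis .
  qed
  then show ?thesis
    using LIMSEQ_le_const2[OF lim, of "\<Sum>n. ennreal (norm (f n))"] by metis
qed

lemma ennreal_le_suminf:
  fixes f :: "nat \<Rightarrow> real"
  assumes "f sums s"
  shows "ennreal s \<le> (\<Sum>n. ennreal (f n))"
proof -
  have lim: "(\<lambda>n. ennreal (\<Sum>i<n. f i)) \<longlonglongrightarrow> ennreal s"
    using assms unfolding sums_def by (intro tendsto_intros)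
  have "ennreal (\<Sum>i<n. f i) \<le> (\<Sum>n. ennreal (f n))" for n
  proof -
    have "ennreal (\<Sum>i<n. f i) \<le> ennreal (\<Sum>i<n. max 0 (f i))"
      by (intro ennreal_leI sum_mono) simp
    also have "\<dots> = (\<Sum>i<n. ennreal (max 0 (f i)))" by (rule sum_ennreal[symmetric]) simp
    also have "\<dots> = (\<Sum>i<n. ennreal (f i))"
      by (simp add: ennreal_max_0)
    also have "\<dots> \<le> (\<Sum>n. ennreal (f n))" by (rule sum_le_suminf) auto
    finally show ?thesis .
  qed
  then show ?thesis
    using LIMSEQ_le_const2[OF lim, of "\<Sum>n. ennreal (f n)"] by metis
qed

lemma suminf_swap_ennreal:
  fixes f :: "nat \<Rightarrow> nat \<Rightarrow> ennreal"
  shows "(\<Sum>i. \<Sum>j. f i j) = (\<Sum>j. \<Sum>i. f i j)"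
  using nn_integral_suminf[of "\<lambda>i j. f i j" "count_space UNIV"]
  by (simp add: nn_integral_count_space_nat)

lemma measure_space_if_superadditive:
  fixes V :: "'a set \<Rightarrow> ennreal"
  assumes zero: "V {} = 0"
    and mono: "\<And>A B. A \<in> sets M \<Longrightarrow> B \<in> sets M \<Longrightarrow> A \<subseteq> B \<Longrightarrow> V A \<le> V B"
    and super: "\<And>A B. A \<in> sets M \<Longrightarrow> B \<in> sets M \<Longrightarrow> A \<inter> B = {} \<Longrightarrow> V A + V B \<le> V (A \<union> B)"
    and sub: "\<And>A :: nat \<Rightarrow> 'a set. range A \<subseteq> sets M \<Longrightarrow> disjoint_family A \<Longrightarrow>
                V (\<Union>n. A n) \<le> (\<Sum>n. V (A n))"
  shows "positive (sets M) V" "countably_additive (sets M) V"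
proof -
  show "positive (sets M) V" using zero by (simp add: positive_def)
  show "countably_additive (sets M) V"
  proof (rule countably_additiveI)
    fix A :: "nat \<Rightarrow> 'a set"
    assume A: "range A \<subseteq> sets M" "disjoint_family A"
    have fin: "(\<Sum>i<n. V (A i)) \<le> V (\<Union>i<n. A i)" for n
    proof (induction n)
      case (Suc n)
      have dis: "(\<Union>i<n. A i) \<inter> A n = {}"
      proof -
        have "A i \<inter> A n = {}" if "i < n" for i
          using A(2) that by (auto simp: disjoint_family_on_def)
        then show ?thesis by blast
      qed
      have "(\<Sum>i<Suc n. V (A i)) \<le> V (\<Union>i<n. A i) + V (A n)"
        using Suc by (simp add: add_right_mono)
      also have "\<dots> \<le> V ((\<Union>i<n. A i) \<union> A n)"
        by (rule super) (use A(1) dis in auto)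
      finally show ?case by (simp add: lessThan_Suc Un_commute)
    qed (simp add: zero)
    have "(\<Sum>i. V (A i)) \<le> V (\<Union>i. A i)"
    proof (rule suminf_le_const)
      show "(\<Sum>i<n. V (A i)) \<le> V (\<Union>i. A i)" for n
        by (rule order_trans[OF fin mono]) (use A(1) in auto)
    qed simp
    with sub[OF A] show "(\<Sum>i. V (A i)) = V (\<Union>i. A i)" by (rule order_antisym[rotated])
  qed
qed

lemma space_total_variation [simp]: "space (total_variation M \<mu>) = space M"
  and sets_total_variation [simp, measurable_cong]: "sets (total_variation M \<mu>) = sets M"
  by (simp_all add: total_variation_def)

lemma space_positive_variation [simp]: "space (positive_variation M \<nu>) = space M"
  and sets_positive_variation [simp, measurable_cong]: "sets (positive_variation M \<nu>) = sets M"
  by (simp_all add: positive_variation_def)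

lemma emeasure_total_variation:
  fixes \<mu> :: "'a set \<Rightarrow> 'b::real_normed_vector"
  assumes vm: "vector_measure M \<mu>" and A: "A \<in> sets M"
  shows "emeasure (total_variation M \<mu>) A =
     (SUP F \<in> {F :: nat \<Rightarrow> 'a set. range F \<subseteq> sets M \<and> disjoint_family F \<and> (\<Union>n. F n) = A}.
        \<Sum>n. ennreal (norm (\<mu> (F n))))"
proof -
  define P where "P A = {F :: nat \<Rightarrow> 'a set. range F \<subseteq> sets M \<and> disjoint_family F \<and> (\<Union>n. F n) = A}"
    for A
  define S where "S F = (\<Sum>n. ennreal (norm (\<mu> (F n))))" for F :: "nat \<Rightarrow> 'a set"
  define V where "V A = (SUP F \<in> P A. S F)" for A
  note \<mu>0 = vector_measure_empty[OF vm]
  have ne: "binaryset A {} \<in> P A" if "A \<in> sets M" for A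
    using that by (auto simp: P_def binaryset_def disjoint_family_on_def split: if_splits)
  have zero: "V {} = 0"
  proof -
    have "S F = 0" if "F \<in> P {}" for F
    proof -
      have "F n = {}" for n using that by (auto simp: P_def)
      then show ?thesis by (simp add: S_def \<mu>0)
    qed
    then have "V {} \<le> 0" unfolding V_def by (intro SUP_least) simp
    then show ?thesis by simp
  qed
  have super: "V A + V B \<le> V (A \<union> B)"
    if AB: "A \<in> sets M" "B \<in> sets M" "A \<inter> B = {}" for A B
  proof -
    have key: "S F + S G \<le> V (A \<union> B)" if FG: "F \<in> P A" "G \<in> P B" for F G
    proof -
      define H where "H k = (case prod_decode k of (i, j) \<Rightarrow>
        if i = 0 then F j else if i = 1 then G j else {})" for k
      have sub: "F j \<subseteq> A" "G j \<subseteq> B" for j using FG by (auto simp: P_def)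
      have disj: "H k \<inter> H l = {}" if "k \<noteq> l" for k l
      proof -
        obtain i j where ij: "prod_decode k = (i, j)" by fastforce
        obtain i' j' where ij': "prod_decode l = (i', j')" by fastforce
        have "(i, j) \<noteq> (i', j')" using that ij ij' by (metis prod_decode_inverse)
        moreover have "F j \<inter> F j' = {}" "G j \<inter> G j' = {}" if "j \<noteq> j'"
          using FG that by (auto simp: P_def disjoint_family_on_def)
        moreover have "F j \<inter> G j' = {}" "G j \<inter> F j' = {}" using sub AB(3) by blast+
        ultimately show ?thesis using ij ij' by (auto simp: H_def)
      qed
      have "(\<Union>k. H k) = A \<union> B"
      proof
        show "(\<Union>k. H k) \<subseteq> A \<union> B"
        proof (rule UN_least)
          fix k
          obtain i j where "prod_decode k = (i, j)" by fastforce
          then show "H k \<subseteq> A \<union> B"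
            using sub(1)[of j] sub(2)[of j] by (auto simp: H_def)
        qed
        have "F j \<subseteq> H (prod_encode (0, j))" "G j \<subseteq> H (prod_encode (1, j))" for j
          by (simp_all add: H_def)
        then have "(\<Union>j. F j) \<union> (\<Union>j. G j) \<subseteq> (\<Union>k. H k)" by blast
        then show "A \<union> B \<subseteq> (\<Union>k. H k)" using FG by (simp add: P_def)
      qed
      moreover have "range H \<subseteq> sets M"
        using FG by (auto simp: P_def H_def split: prod.splits)
      ultimately have "H \<in> P (A \<union> B)"
        using disj by (auto simp: P_def disjoint_family_on_def)
      then have "S H \<le> V (A \<union> B)" unfolding V_def by (rule SUP_upper)
      moreover have "S H = S F + S G"
      proof -
        define h where "h p = (case p of (i, j) \<Rightarrow> ennreal (norm (\<mu> (
          if i = 0 then F j else if i = 1 then G j else {}))))" for p :: "nat \<times> nat"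
        have "S H = (\<Sum>k. h (prod_decode k))"
          unfolding S_def by (intro suminf_cong) (simp add: H_def h_def split: prod.splits)
        also have "\<dots> = (\<Sum>i. \<Sum>j. h (i, j))"
          by (rule suminf_ennreal_2dimen) simp
        also have "\<dots> = (\<Sum>i\<in>{0, 1::nat}. \<Sum>j. h (i, j))"
          by (rule suminf_finite) (auto simp: h_def \<mu>0)
        also have "\<dots> = S F + S G" by (simp add: h_def S_def)
        finally show ?thesis .
      qed
      ultimately show ?thesis by simp
    qed
    have "V A + V B = (SUP F \<in> P A. S F + V B)"
      unfolding V_def using ne[OF AB(1)] by (intro ennreal_SUP_add_left[symmetric]) auto
    also have "\<dots> \<le> V (A \<union> B)"
    proof (rule SUP_least)
      fix F assume F: "F \<in> P A"
      have "S F + V B = (SUP G \<in> P B. S F + S G)"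
        unfolding V_def using ne[OF AB(2)] by (intro ennreal_SUP_add_right) auto
      also have "\<dots> \<le> V (A \<union> B)" using key[OF F] by (intro SUP_least)
      finally show "S F + V B \<le> V (A \<union> B)" .
    qed
    finally show ?thesis .
  qed
  have mono: "V A \<le> V B" if "A \<in> sets M" "B \<in> sets M" "A \<subseteq> B" for A B
  proof -
    have "V A \<le> V A + V (B - A)" by simp
    also have "\<dots> \<le> V (A \<union> (B - A))" by (rule super) (use that in auto)
    also have "A \<union> (B - A) = B" using that by auto
    finally show ?thesis .
  qed
  have sub: "V (\<Union>n. A n) \<le> (\<Sum>n. V (A n))"
    if A: "range A \<subseteq> sets M" "disjoint_family A" for A :: "nat \<Rightarrow> 'a set"
    unfolding V_def[of "\<Union>n. A n"]
  proof (rule SUP_least)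
    fix G assume G: "G \<in> P (\<Union>n. A n)"
    have "S G \<le> (\<Sum>n. \<Sum>i. ennreal (norm (\<mu> (G n \<inter> A i))))"
      unfolding S_def
    proof (intro suminf_le allI)
      fix n
      have "(\<lambda>i. \<mu> (G n \<inter> A i)) sums \<mu> (\<Union>i. G n \<inter> A i)"
        using A G by (intro vector_measure_sums[OF vm]) (auto simp: P_def disjoint_family_on_def)
      moreover have "(\<Union>i. G n \<inter> A i) = G n" using G by (auto simp: P_def)
      ultimately show "ennreal (norm (\<mu> (G n))) \<le> (\<Sum>i. ennreal (norm (\<mu> (G n \<inter> A i))))"
        by (intro ennreal_norm_le_suminf) simp
    qed auto
    also have "\<dots> = (\<Sum>i. S (\<lambda>n. G n \<inter> A i))"
      unfolding S_def by (rule suminf_swap_ennreal)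
    also have "\<dots> \<le> (\<Sum>i. V (A i))"
    proof (intro suminf_le allI)
      fix i
      have "(\<Union>n. G n \<inter> A i) = A i" using G by (auto simp: P_def)
      moreover have "range (\<lambda>n. G n \<inter> A i) \<subseteq> sets M"
        using A G by (auto simp: P_def)
      moreover have "disjoint_family (\<lambda>n. G n \<inter> A i)"
        using G unfolding P_def disjoint_family_on_def by blast
      ultimately have "(\<lambda>n. G n \<inter> A i) \<in> P (A i)"
        by (simp add: P_def)
      then show "S (\<lambda>n. G n \<inter> A i) \<le> V (A i)" unfolding V_def by (rule SUP_upper)
    qed auto
    finally show "S G \<le> (\<Sum>n. V (A n))" .
  qed
  have "emeasure (measure_of (space M) (sets M) V) A = V A"
    by (rule emeasure_measure_of_sigma[OF sets.sigma_algebra_axioms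
          measure_space_if_superadditive[OF zero mono super sub] A])
  then show ?thesis
    by (simp only: total_variation_def V_def[abs_def] P_def S_def[abs_def])
qed

lemma emeasure_positive_variation:
  assumes vm: "vector_measure M \<nu>" and A: "A \<in> sets M"
  shows "emeasure (positive_variation M \<nu>) A = (SUP B \<in> {B \<in> sets M. B \<subseteq> A}. ennreal (\<nu> B))"
proof -
  define P where "P A = {B \<in> sets M. B \<subseteq> A}" for A
  define V where "V A = (SUP B \<in> P A. ennreal (\<nu> B))" for A
  note \<nu>0 = vector_measure_empty[OF vm]
  have emp: "{} \<in> P A" for A by (simp add: P_def)
  have zero: "V {} = 0"
  proof -
    have "P {} = {{}}" by (auto simp: P_def)
    then show ?thesis by (simp add: V_def \<nu>0)
  qed
  have mono: "V A \<le> V B" if "A \<in> sets M" "B \<in> sets M" "A \<subseteq> B" for A B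
    unfolding V_def by (rule SUP_subset_mono) (use that in \<open>auto simp: P_def\<close>)
  have super: "V A + V B \<le> V (A \<union> B)"
    if AB: "A \<in> sets M" "B \<in> sets M" "A \<inter> B = {}" for A B
  proof -
    have key: "ennreal (\<nu> C) + ennreal (\<nu> D) \<le> V (A \<union> B)" if "C \<in> P A" "D \<in> P B" for C D
    proof -
      define C' where "C' = (if \<nu> C \<ge> 0 then C else {})"
      define D' where "D' = (if \<nu> D \<ge> 0 then D else {})"
      have CD: "C' \<in> P A" "D' \<in> P B" "\<nu> C' \<ge> 0" "\<nu> D' \<ge> 0"
        "ennreal (\<nu> C') = ennreal (\<nu> C)" "ennreal (\<nu> D') = ennreal (\<nu> D)"
        using that by (auto simp: C'_def D'_def \<nu>0 P_def ennreal_neg)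
      have "\<nu> (C' \<union> D') = \<nu> C' + \<nu> D'"
        using CD AB by (intro vector_measure_Un[OF vm]) (auto simp: P_def)
      then have "ennreal (\<nu> C) + ennreal (\<nu> D) = ennreal (\<nu> (C' \<union> D'))"
        using CD by (simp add: ennreal_plus)
      also have "C' \<union> D' \<in> P (A \<union> B)" using CD by (auto simp: P_def)
      then have "ennreal (\<nu> (C' \<union> D')) \<le> V (A \<union> B)" unfolding V_def by (rule SUP_upper)
      finally show ?thesis .
    qed
    have "V A + V B = (SUP C \<in> P A. ennreal (\<nu> C) + V B)"
      unfolding V_def using emp by (intro ennreal_SUP_add_left[symmetric]) auto
    also have "\<dots> \<le> V (A \<union> B)"
    proof (rule SUP_least)
      fix C assume C: "C \<in> P A"
      have "ennreal (\<nu> C) + V B = (SUP D \<in> P B. ennreal (\<nu> C) + ennreal (\<nu> D))"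
        unfolding V_def using emp by (intro ennreal_SUP_add_right) auto
      also have "\<dots> \<le> V (A \<union> B)" using key[OF C] by (intro SUP_least)
      finally show "ennreal (\<nu> C) + V B \<le> V (A \<union> B)" .
    qed
    finally show ?thesis .
  qed
  have sub: "V (\<Union>n. A n) \<le> (\<Sum>n. V (A n))"
    if A: "range A \<subseteq> sets M" "disjoint_family A" for A :: "nat \<Rightarrow> 'a set"
    unfolding V_def[of "\<Union>n. A n"]
  proof (rule SUP_least)
    fix B assume B: "B \<in> P (\<Union>n. A n)"
    have "(\<lambda>i. \<nu> (B \<inter> A i)) sums \<nu> (\<Union>i. B \<inter> A i)"
      using A B by (intro vector_measure_sums[OF vm]) (auto simp: P_def disjoint_family_on_def)
    moreover have "(\<Union>i. B \<inter> A i) = B" using B by (auto simp: P_def)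
    ultimately have "ennreal (\<nu> B) \<le> (\<Sum>i. ennreal (\<nu> (B \<inter> A i)))"
      by (intro ennreal_le_suminf) simp
    also have "\<dots> \<le> (\<Sum>i. V (A i))"
    proof (intro suminf_le allI)
      fix i
      have "B \<inter> A i \<in> P (A i)" using A B by (auto simp: P_def)
      then show "ennreal (\<nu> (B \<inter> A i)) \<le> V (A i)" unfolding V_def by (rule SUP_upper)
    qed auto
    finally show "ennreal (\<nu> B) \<le> (\<Sum>n. V (A n))" .
  qed
  have "emeasure (measure_of (space M) (sets M) V) A = V A"
    by (rule emeasure_measure_of_sigma[OF sets.sigma_algebra_axioms
          measure_space_if_superadditive[OF zero mono super sub] A])
  then show ?thesis
    by (simp only: positive_variation_def V_def[abs_def] P_def)
qed

end

theory Submission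
  imports Defs "HOL-Library.Function_Algebras"
begin

text \<open>
  The inequality "\<open>\<le>\<close>" is weak duality: if \<open>\<pi>\<close> transports \<open>\<mu>\<close>, then the integral of \<open>\<langle>u, d\<mu>\<rangle>\<close> equals
  that of \<open>\<langle>u x - u y, d\<pi>\<rangle>\<close> and is therefore at most the cost of \<open>\<pi>\<close>. This is literally true for bounded \<open>u\<close>
  (\<open>inner_integral_transport\<close>); a Lipschitz \<open>u\<close> is truncated first (\<open>weak_duality\<close>).

  The inequality "\<open>\<ge>\<close>" and the existence of a maximiser come from one construction
  (\<open>dual_attained\<close>). The Wasserstein norm is a finite seminorm on the Wasserstein space, so by
  Hahn-Banach there is a linear functional \<open>\<phi>\<close> below it with equality at \<open>\<mu>\<close>. On dipoles, that is
  measures \<open>v \<delta>\<^sub>x - v \<delta>\<^sub>y\<close>, the functional is linear in \<open>v\<close>, so it is given there by a function \<open>u\<close> with values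
  in \<open>real ^ 'm\<close>; since the dipole has norm at most \<open>\<parallel>v\<parallel> * dist x y\<close>, the function \<open>u\<close> is
  1-Lipschitz. Sums of dipoles are dense, because \<open>\<mu>\<close> can be pushed forward by simple maps close to the
  identity (\<open>push_forward_simple_eq_sum_dipoles\<close>, \<open>map_transport\<close>). Hence \<open>\<phi> \<mu>\<close> is the integral of
  \<open>\<langle>u, d\<mu>\<rangle>\<close>, and \<open>u\<close> is optimal.

  The measure theory underneath consists of the boundedness of vector measures
  (\<open>vector_measure_bounded\<close>), the Jordan decomposition, the minimality of the total variation among
  dominating measures (\<open>total_variation_least\<close>) and dominated convergence for
  \<^const>\<open>inner_integral\<close>.
\<close>

section \<open>The Hahn-Banach theorem for sublinear functionals\<close>

text \<open>
  For positive scalars only the inequality is demanded: applied to \<^term>\<open>inverse c\<close> it gives the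
  reverse one, so that equality is automatic.
\<close>

definition sublinear :: "('v::real_vector \<Rightarrow> real) \<Rightarrow> bool" where
  "sublinear p \<longleftrightarrow> (\<forall>x y. p (x + y) \<le> p x + p y) \<and> (\<forall>c x. c > 0 \<longrightarrow> p (c *\<^sub>R x) \<le> c * p x)"

lemma sublinear_add: "sublinear p \<Longrightarrow> p (x + y) \<le> p x + p y"
  by (simp add: sublinear_def)

lemma sublinear_scaleR:
  assumes "sublinear p" "c > 0"
  shows "p (c *\<^sub>R x) = c * p x"
proof (rule antisym)
  show "p (c *\<^sub>R x) \<le> c * p x" using assms by (simp add: sublinear_def)
  have "p (inverse c *\<^sub>R (c *\<^sub>R x)) \<le> inverse c * p (c *\<^sub>R x)"
    using assms unfolding sublinear_def by (meson inverse_positive_iff_positive)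
  then show "c * p x \<le> p (c *\<^sub>R x)" using assms(2) by (simp add: field_simps)
qed

lemma sublinear_0:
  assumes "sublinear p" shows "p 0 = 0"
  using sublinear_scaleR[OF assms, of 2 0] by simp

lemma sublinear_minus:
  assumes "sublinear p" shows "- p (- x) \<le> p x"
  using sublinear_add[OF assms, of x "- x"] sublinear_0[OF assms] by simp

text \<open>
  The pointwise infimum is finite because each member \<open>q\<close> satisfies \<open>- p (- x) \<le> - q (- x) \<le> q x\<close>.
  Subadditivity needs the chain property: for two members \<open>q\<close> and \<open>r\<close> the smaller of them bounds the
  infimum at \<open>x + y\<close> by \<open>q x + r y\<close>.
\<close>

lemma sublinear_Inf_chain:
  assumes C: "C \<noteq> {}" "\<And>q. q \<in> C \<Longrightarrow> sublinear q" "\<And>q. q \<in> C \<Longrightarrow> q \<le> p"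
    and chain: "\<And>q r. q \<in> C \<Longrightarrow> r \<in> C \<Longrightarrow> q \<le> r \<or> r \<le> q"
  shows "sublinear (\<lambda>x. INF q\<in>C. q x)" "\<And>q. q \<in> C \<Longrightarrow> (\<lambda>x. INF q\<in>C. q x) \<le> q"
proof -
  have bdd: "bdd_below ((\<lambda>q. q x) ` C)" for x
  proof (rule bdd_belowI2)
    fix q assume q: "q \<in> C"
    have "- p (- x) \<le> - q (- x)" using C(3)[OF q] by (simp add: le_fun_def)
    also have "\<dots> \<le> q x" by (rule sublinear_minus[OF C(2)[OF q]])
    finally show "- p (- x) \<le> q x" .
  qed
  show lower: "(\<lambda>x. INF q\<in>C. q x) \<le> q" if "q \<in> C" for q
    using cINF_lower[OF bdd that] by (simp add: le_fun_def)
  have add: "(INF q\<in>C. q (x + y)) \<le> q x + r y" if qr: "q \<in> C" "r \<in> C" for q r x y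
  proof -
    obtain s where s: "s \<in> C" "s \<le> q" "s \<le> r" using chain[OF qr] qr by auto
    have "(INF q\<in>C. q (x + y)) \<le> s (x + y)" by (rule cINF_lower[OF bdd s(1)])
    also have "\<dots> \<le> s x + s y" by (rule sublinear_add[OF C(2)[OF s(1)]])
    also have "\<dots> \<le> q x + r y" using s(2,3) by (intro add_mono) (auto simp: le_fun_def)
    finally show ?thesis .
  qed
  show "sublinear (\<lambda>x. INF q\<in>C. q x)"
    unfolding sublinear_def
  proof (intro conjI allI impI)
    fix x y
    have "(INF q\<in>C. q (x + y)) - r y \<le> (INF q\<in>C. q x)" if r: "r \<in> C" for r
      by (rule cINF_greatest[OF C(1)]) (use add[OF _ r, of _ x y] in \<open>simp add: algebra_simps\<close>)
    then have "(INF q\<in>C. q (x + y)) - (INF q\<in>C. q x) \<le> (INF r\<in>C. r y)"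
      by (intro cINF_greatest[OF C(1)]) (simp add: algebra_simps)
    then show "(INF q\<in>C. q (x + y)) \<le> (INF q\<in>C. q x) + (INF q\<in>C. q y)" by simp
  next
    fix c :: real and x assume c: "c > 0"
    have "inverse c * (INF q\<in>C. q (c *\<^sub>R x)) \<le> (INF q\<in>C. q x)"
    proof (rule cINF_greatest[OF C(1)])
      fix q assume q: "q \<in> C"
      have "(INF q\<in>C. q (c *\<^sub>R x)) \<le> c * q x"
        using cINF_lower[OF bdd q] sublinear_scaleR[OF C(2)[OF q] c] by metis
      then show "inverse c * (INF q\<in>C. q (c *\<^sub>R x)) \<le> q x" using c by (simp add: field_simps)
    qed
    then show "(INF q\<in>C. q (c *\<^sub>R x)) \<le> c * (INF q\<in>C. q x)" using c by (simp add: field_simps)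
  qed
qed

text \<open>
  The largest sublinear functional below \<open>p\<close> whose value at \<open>- y\<close> is at most \<open>- p y\<close>, that is, the
  result of forcing \<open>p\<close> to be linear along the line through \<open>y\<close>.
\<close>

definition directional_inf :: "('v::real_vector \<Rightarrow> real) \<Rightarrow> 'v \<Rightarrow> 'v \<Rightarrow> real" where
  "directional_inf p y x = (INF t\<in>{0..}. p (x + t *\<^sub>R y) - t * p y)"

lemma directional_inf_le:
  assumes "sublinear p" "t \<ge> 0"
  shows "directional_inf p y x \<le> p (x + t *\<^sub>R y) - t * p y"
proof -
  have "bdd_below ((\<lambda>t. p (x + t *\<^sub>R y) - t * p y) ` {0..})"
  proof (rule bdd_belowI2)
    fix t :: real assume "t \<in> {0..}"
    then have "t * p y = p (t *\<^sub>R y)"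
      using sublinear_scaleR[OF assms(1), of t] sublinear_0[OF assms(1)] by (cases "t = 0") auto
    also have "\<dots> \<le> p (x + t *\<^sub>R y) + p (- x)"
      using sublinear_add[OF assms(1), of "x + t *\<^sub>R y" "- x"] by simp
    finally show "- p (- x) \<le> p (x + t *\<^sub>R y) - t * p y" by simp
  qed
  then show ?thesis unfolding directional_inf_def by (rule cINF_lower) (use assms in simp)
qed

lemma directional_inf_greatest:
  assumes "\<And>t. t \<ge> 0 \<Longrightarrow> a \<le> p (x + t *\<^sub>R y) - t * p y"
  shows "a \<le> directional_inf p y x"
  unfolding directional_inf_def by (rule cINF_greatest) (use assms in auto)

lemma sublinear_directional_inf:
  assumes p: "sublinear p"
  shows "sublinear (directional_inf p y)"
  unfolding sublinear_def
proof (intro conjI allI impI)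
  fix x x'
  have *: "directional_inf p y (x + x') \<le> (p (x + s *\<^sub>R y) - s * p y) + (p (x' + t *\<^sub>R y) - t * p y)"
    if "s \<ge> 0" "t \<ge> 0" for s t
  proof -
    have "directional_inf p y (x + x') \<le> p ((x + x') + (s + t) *\<^sub>R y) - (s + t) * p y"
      using that by (intro directional_inf_le[OF p]) simp
    also have "(x + x') + (s + t) *\<^sub>R y = (x + s *\<^sub>R y) + (x' + t *\<^sub>R y)"
      by (simp add: algebra_simps)
    finally show ?thesis
      using sublinear_add[OF p, of "x + s *\<^sub>R y" "x' + t *\<^sub>R y"] by (simp add: algebra_simps)
  qed
  have "directional_inf p y (x + x') - (p (x' + t *\<^sub>R y) - t * p y) \<le> directional_inf p y x"
    if "t \<ge> 0" for t
    by (rule directional_inf_greatest) (use *[OF _ that] in \<open>simp add: algebra_simps\<close>)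
  then have "directional_inf p y (x + x') - directional_inf p y x \<le> directional_inf p y x'"
    by (intro directional_inf_greatest) (simp add: algebra_simps)
  then show "directional_inf p y (x + x') \<le> directional_inf p y x + directional_inf p y x'" by simp
next
  fix c :: real and x assume c: "c > 0"
  have "inverse c * directional_inf p y (c *\<^sub>R x) \<le> directional_inf p y x"
  proof (rule directional_inf_greatest)
    fix t :: real assume t: "t \<ge> 0"
    have "directional_inf p y (c *\<^sub>R x) \<le> p (c *\<^sub>R x + (c * t) *\<^sub>R y) - (c * t) * p y"
      using c t by (intro directional_inf_le[OF p]) simp
    also have "c *\<^sub>R x + (c * t) *\<^sub>R y = c *\<^sub>R (x + t *\<^sub>R y)" by (simp add: algebra_simps)
    also have "p \<dots> = c * p (x + t *\<^sub>R y)" by (rule sublinear_scaleR[OF p c])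
    finally show "inverse c * directional_inf p y (c *\<^sub>R x) \<le> p (x + t *\<^sub>R y) - t * p y"
      using c by (simp add: field_simps)
  qed
  then show "directional_inf p y (c *\<^sub>R x) \<le> c * directional_inf p y x"
    using c by (simp add: field_simps)
qed

text \<open>
  Forcing linearity along \<open>y\<close> cannot decrease a minimal \<open>p\<close>; the term \<open>t = 1\<close> of the infimum then
  gives \<open>p x \<le> p (x + y) - p y\<close>, the missing half of additivity.
\<close>

lemma minimal_sublinear_imp_linear:
  assumes p: "sublinear p" and min: "\<And>q. sublinear q \<Longrightarrow> q \<le> p \<Longrightarrow> q = p"
  shows "linear p"
proof -
  have add: "p (x + y) = p x + p y" for x y
  proof -
    have "directional_inf p y \<le> p"
      using directional_inf_le[OF p, of 0 y] by (simp add: le_fun_def)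
    then have "directional_inf p y = p" by (intro min sublinear_directional_inf[OF p])
    then have "p x \<le> p (x + y) - p y" using directional_inf_le[OF p, of 1 y x] by simp
    then show ?thesis using sublinear_add[OF p, of x y] by simp
  qed
  have minus: "p (- x) = - p x" for x
    using add[of x "- x"] sublinear_0[OF p] by simp
  show ?thesis
  proof (rule linearI)
    fix c :: real and x
    consider "c > 0" | "c = 0" | "c < 0" by linarith
    then show "p (c *\<^sub>R x) = c *\<^sub>R p x"
    proof cases
      case 3
      then have "p ((- c) *\<^sub>R x) = (- c) * p x" by (intro sublinear_scaleR[OF p]) simp
      then show ?thesis using minus[of "c *\<^sub>R x"] by simp
    qed (simp_all add: sublinear_scaleR[OF p] sublinear_0[OF p])
  qed (rule add)
qed

text \<open>
  A minimal sublinear functional below \<open>p\<close> is linear. To make it touch \<open>p\<close> at \<open>x0\<close>, minimality is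
  taken below the functional that has first been made linear along \<open>x0\<close>.
\<close>

lemma Hahn_Banach_sublinear:
  assumes p: "sublinear p"
  obtains f where "linear f" "\<And>x. f x \<le> p x" "f x0 = p x0"
proof -
  define p0 where "p0 = directional_inf p x0"
  have p0: "sublinear p0" unfolding p0_def by (rule sublinear_directional_inf[OF p])
  have p0_le: "p0 x \<le> p x" for x
    using directional_inf_le[OF p, of 0 x0 x] by (simp add: p0_def)
  have p0_x0: "p0 (- x0) \<le> - p x0"
    using directional_inf_le[OF p, of 1 x0 "- x0"] sublinear_0[OF p] by (simp add: p0_def)
  define Q where "Q = {q. sublinear q \<and> q \<le> p0}"
  have "\<exists>f\<in>Q. \<forall>q\<in>Q. f \<ge> q \<longrightarrow> q = f"
  proof (rule predicate_Zorn)
    show "partial_order_on Q (relation_of (\<ge>) Q)"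
      by (rule partial_order_on_relation_ofI) auto
    fix C assume C: "C \<in> Chains (relation_of (\<ge>) Q)"
    then have CQ: "C \<subseteq> Q" by (rule Chains_relation_of)
    show "\<exists>u\<in>Q. \<forall>a\<in>C. a \<ge> u"
    proof (cases "C = {}")
      case True
      then show ?thesis using p0 by (auto simp: Q_def)
    next
      case False
      have chain: "q \<le> r \<or> r \<le> q" if "q \<in> C" "r \<in> C" for q r
        using C that by (auto simp: Chains_def relation_of_def)
      have sub: "sublinear q" "q \<le> p0" if "q \<in> C" for q using that CQ by (auto simp: Q_def)
      note inf = sublinear_Inf_chain[of C p0, OF False sub chain]
      obtain q where q: "q \<in> C" using False by auto
      have "(\<lambda>x. INF q\<in>C. q x) \<le> q" if "q \<in> C" for q using inf(2) that by blast
      moreover from this[OF q] have "(\<lambda>x. INF q\<in>C. q x) \<in> Q"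
        using inf(1) sub(2)[OF q] by (auto simp: Q_def intro: order_trans)
      ultimately show ?thesis by blast
    qed
  qed
  then obtain f where f: "f \<in> Q" "\<And>q. q \<in> Q \<Longrightarrow> q \<le> f \<Longrightarrow> q = f" by blast
  have f_le: "f x \<le> p0 x" for x using f(1) by (simp add: Q_def le_fun_def)
  have lin: "linear f"
  proof (rule minimal_sublinear_imp_linear)
    show "sublinear f" using f(1) by (simp add: Q_def)
    show "q = f" if "sublinear q" "q \<le> f" for q
      using that f order_trans[of q f p0] by (auto simp: Q_def)
  qed
  have "- f x0 \<le> - p x0"
    using f_le[of "- x0"] p0_x0 linear_neg[OF lin, of x0] by simp
  then have "f x0 = p x0" using f_le[of x0] p0_le[of x0] by simp
  then show thesis using that[OF lin] f_le p0_le order_trans by blast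
qed

text \<open>
  A functional that is sublinear only on a subspace is composed with a linear projection onto it.
\<close>

lemma Hahn_Banach_subspace:
  fixes p :: "'v::real_vector \<Rightarrow> real"
  assumes S: "subspace S" and x0: "x0 \<in> S"
    and add: "\<And>x y. x \<in> S \<Longrightarrow> y \<in> S \<Longrightarrow> p (x + y) \<le> p x + p y"
    and scale: "\<And>c x. c > 0 \<Longrightarrow> x \<in> S \<Longrightarrow> p (c *\<^sub>R x) \<le> c * p x"
  obtains f where "linear f" "\<And>x. x \<in> S \<Longrightarrow> f x \<le> p x" "f x0 = p x0"
proof -
  obtain g :: "'v \<Rightarrow> 'v" where g: "\<And>x. g x \<in> S" "linear g" "\<And>x. x \<in> S \<Longrightarrow> g x = x"
    using linear_exists_left_inverse_on[OF linear_id S] by auto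
  have "sublinear (\<lambda>x. p (g x))"
    using g(1) add scale by (auto simp: sublinear_def linear_add[OF g(2)] linear_scale[OF g(2)])
  from Hahn_Banach_sublinear[OF this, of x0] obtain f
    where "linear f" "\<And>x. f x \<le> p (g x)" "f x0 = p (g x0)" by metis
  then show thesis using that[of f] g(3) x0 by metis
qed

section \<open>Vector measures and their variations\<close>

lemma vector_measure_Diff:
  assumes "vector_measure M \<mu>" "A \<in> sets M" "B \<in> sets M" "A \<subseteq> B"
  shows "\<mu> (B - A) = \<mu> B - \<mu> A"
proof -
  have "A \<union> (B - A) = B" using assms(4) by auto
  then show ?thesis using vector_measure_Un[OF assms(1), of A "B - A"] assms(2,3) by auto
qed

text \<open>
  Call a set bad if the measure is unbounded on its subsets. A bad set splits into two parts of which
  one is bad again and the other has measure of norm at least 1. Iterating from the whole space peels off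
  infinitely many disjoint sets of norm at least 1, which contradicts countable additivity.
\<close>

lemma vector_measure_bounded:
  fixes \<mu> :: "'a set \<Rightarrow> 'b::real_normed_vector"
  assumes vm: "vector_measure M \<mu>"
  obtains K where "\<And>A. A \<in> sets M \<Longrightarrow> norm (\<mu> A) \<le> K"
proof -
  define bad where "bad E \<longleftrightarrow> E \<in> sets M \<and> (\<forall>K. \<exists>C\<in>sets M. C \<subseteq> E \<and> norm (\<mu> C) > K)" for E
  have split: "bad C \<or> bad (E - C)" if E: "bad E" and C: "C \<in> sets M" for C E
  proof (rule ccontr)
    assume "\<not> (bad C \<or> bad (E - C))"
    then have "\<not> bad C" "\<not> bad (E - C)" by simp_all
    moreover have "E - C \<in> sets M" using E C by (auto simp: bad_def)
    ultimately obtain K K' where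
      K: "\<forall>D\<in>sets M. D \<subseteq> C \<longrightarrow> norm (\<mu> D) \<le> K" and
      K': "\<forall>D\<in>sets M. D \<subseteq> E - C \<longrightarrow> norm (\<mu> D) \<le> K'"
      using C unfolding bad_def by (meson not_less)
    obtain D where D: "D \<in> sets M" "D \<subseteq> E" "norm (\<mu> D) > K + K'"
      using E unfolding bad_def by blast
    have "\<mu> D = \<mu> (D \<inter> C) + \<mu> (D - C)"
      using vector_measure_Un[OF vm, of "D \<inter> C" "D - C"] D C by (auto simp: Int_Diff_Un)
    then have "norm (\<mu> D) \<le> norm (\<mu> (D \<inter> C)) + norm (\<mu> (D - C))" by (simp add: norm_triangle_ineq)
    also have "\<dots> \<le> K + K'" using D C by (intro add_mono K[rule_format] K'[rule_format]) auto
    finally show False using D(3) by simp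
  qed
  have step: "\<exists>E'. bad E' \<and> (E' \<subseteq> E \<and> norm (\<mu> (E - E')) \<ge> 1)" if E: "bad E" for E
  proof -
    obtain C where C: "C \<in> sets M" "C \<subseteq> E" "norm (\<mu> C) > norm (\<mu> E) + 1"
      using E unfolding bad_def by blast
    \<comment> \<open>Both pieces have norm at least 1, so that it does not matter which of them is bad.\<close>
    have "norm (\<mu> C) \<le> norm (\<mu> E) + norm (\<mu> (E - C))"
      using vector_measure_Diff[OF vm C(1) _ C(2)] E norm_triangle_ineq4[of "\<mu> E" "\<mu> E - \<mu> C"]
      by (simp add: bad_def)
    then have "norm (\<mu> (E - C)) \<ge> 1" using C(3) by simp
    moreover have "E - (E - C) = C" using C(2) by auto
    moreover have "norm (\<mu> C) \<ge> 1" using C(3) norm_ge_zero[of "\<mu> E"] by linarith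
    ultimately show ?thesis using split[OF E C(1)] C(2) by (metis Diff_subset)
  qed
  have "\<not> bad (space M)"
  proof
    assume "bad (space M)"
    then have "\<exists>E. \<forall>n. bad (E n) \<and> (E (Suc n) \<subseteq> E n \<and> norm (\<mu> (E n - E (Suc n))) \<ge> 1)"
      by (intro dependent_nat_choice step) blast
    then obtain E where E: "\<And>n. bad (E n)" "\<And>n. E (Suc n) \<subseteq> E n"
      "\<And>n. norm (\<mu> (E n - E (Suc n))) \<ge> 1"
      by blast
    define D where "D n = E n - E (Suc n)" for n
    have "decseq E" using E(2) by (rule decseq_SucI)
    have "D m \<inter> D n = {}" if "m < n" for m n
      using decseqD[OF \<open>decseq E\<close> Suc_leI[OF that]] by (auto simp: D_def)
    then have "disjoint_family D"
      unfolding disjoint_family_on_def by (metis Int_commute linorder_neqE_nat)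
    moreover have "range D \<subseteq> sets M" using E(1) by (auto simp: D_def bad_def)
    ultimately have "summable (\<lambda>n. \<mu> (D n))"
      using vector_measure_sums[OF vm, of D] sums_summable by blast
    then have "(\<lambda>n. norm (\<mu> (D n))) \<longlonglongrightarrow> 0"
      using summable_LIMSEQ_zero tendsto_norm_zero by blast
    then have "(1::real) \<le> 0" by (rule LIMSEQ_le_const) (use E(3) in \<open>auto simp: D_def\<close>)
    then show False by simp
  qed
  then obtain K where "\<forall>A\<in>sets M. A \<subseteq> space M \<longrightarrow> norm (\<mu> A) \<le> K"
    unfolding bad_def by (meson not_less sets.top)
  then show thesis using sets.sets_into_space by (intro that[of K]) blast
qed

lemma vector_measure_uminus:
  "vector_measure M \<mu> \<Longrightarrow> vector_measure M (\<lambda>A. - \<mu> A)"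
  unfolding vector_measure_def by (intro allI impI sums_minus) simp

lemma vector_measure_add:
  "vector_measure M \<mu> \<Longrightarrow> vector_measure M \<nu> \<Longrightarrow> vector_measure M (\<lambda>A. \<mu> A + \<nu> A)"
  unfolding vector_measure_def by (intro allI impI sums_add) simp_all

lemma vector_measure_finite_UN:
  assumes vm: "vector_measure M \<mu>" and "finite I"
    and "\<And>i. i \<in> I \<Longrightarrow> F i \<in> sets M" and "disjoint_family_on F I"
  shows "\<mu> (\<Union>i\<in>I. F i) = (\<Sum>i\<in>I. \<mu> (F i))"
  using assms(2-)
proof (induction I rule: finite_induct)
  case (insert i I)
  have "F i \<inter> (\<Union>j\<in>I. F j) = {}"
    using insert.prems(2) insert.hyps(2) by (auto simp: disjoint_family_on_def)
  moreover have "disjoint_family_on F I"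
    using insert.prems(2) by (auto simp: disjoint_family_on_def)
  moreover have "(\<Union>j\<in>I. F j) \<in> sets M" using insert.prems(1) insert.hyps(1) by auto
  ultimately show ?case
    using insert vector_measure_Un[OF vm, of "F i" "\<Union>j\<in>I. F j"] by simp
qed (simp add: vector_measure_empty[OF vm])

lemma vector_measure_push_forward:
  fixes g :: "'a \<Rightarrow> 'c"
  assumes vm: "vector_measure M \<mu>" and g: "g \<in> measurable M N"
  shows "vector_measure N (\<lambda>A. \<mu> (g -` A \<inter> space M))"
  unfolding vector_measure_def
proof (intro allI impI)
  fix A :: "nat \<Rightarrow> 'c set" assume A: "range A \<subseteq> sets N" "disjoint_family A"
  have "(\<lambda>n. \<mu> (g -` A n \<inter> space M)) sums \<mu> (\<Union>n. g -` A n \<inter> space M)"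
  proof (rule vector_measure_sums[OF vm])
    show "range (\<lambda>n. g -` A n \<inter> space M) \<subseteq> sets M" using A(1) measurable_sets[OF g] by auto
    show "disjoint_family (\<lambda>n. g -` A n \<inter> space M)"
      using A(2) unfolding disjoint_family_on_def by blast
  qed
  moreover have "(\<Union>n. g -` A n \<inter> space M) = g -` (\<Union>n. A n) \<inter> space M" by blast
  ultimately show "(\<lambda>n. \<mu> (g -` A n \<inter> space M)) sums \<mu> (g -` (\<Union>n. A n) \<inter> space M)" by simp
qed

lemma vector_measure_component:
  fixes \<mu> :: "'a set \<Rightarrow> real ^ 'm"
  shows "vector_measure M \<mu> \<Longrightarrow> vector_measure M (\<lambda>A. \<mu> A $ i)"
  unfolding vector_measure_def by (intro allI impI bounded_linear.sums[OF bounded_linear_vec_nth]) simp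

lemma finite_measure_positive_variation:
  assumes vm: "vector_measure M \<nu>"
  shows "finite_measure (positive_variation M \<nu>)"
proof
  obtain K where K: "\<And>A. A \<in> sets M \<Longrightarrow> norm (\<nu> A) \<le> K" using vector_measure_bounded[OF vm] by blast
  have "emeasure (positive_variation M \<nu>) (space M) \<le> ennreal K"
    unfolding emeasure_positive_variation[OF vm sets.top]
    by (intro SUP_least ennreal_leI) (use K in \<open>fastforce simp: abs_le_iff\<close>)
  then show "emeasure (positive_variation M \<nu>) (space (positive_variation M \<nu>)) \<noteq> \<infinity>"
    by (auto simp: top_unique)
qed

text \<open>
  The Jordan decomposition: from
  \<open>\<nu> B = \<nu> A - \<nu> (A - B) \<le> \<nu> A + \<nu>\<^sup>-(A)\<close> for all measurable \<open>B \<subseteq> A\<close> follows \<open>\<nu>\<^sup>+(A) \<le> \<nu> A + \<nu>\<^sup>-(A)\<close>,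
  and the same inequality for \<open>- \<nu>\<close> is the converse.
\<close>

lemma measure_positive_variation_minus_negative:
  assumes vm: "vector_measure M \<nu>" and A: "A \<in> sets M"
  shows "measure (positive_variation M \<nu>) A - measure (positive_variation M (\<lambda>A. - \<nu> A)) A = \<nu> A"
proof -
  have le: "measure (positive_variation M \<nu>) A \<le> \<nu> A + measure (positive_variation M (\<lambda>A. - \<nu> A)) A"
    if vm: "vector_measure M \<nu>" for \<nu> :: "'a set \<Rightarrow> real"
  proof -
    note vm' = vector_measure_uminus[OF vm]
    interpret N: finite_measure "positive_variation M (\<lambda>A. - \<nu> A)"
      by (rule finite_measure_positive_variation[OF vm'])
    have *: "\<nu> B \<le> \<nu> A + measure (positive_variation M (\<lambda>A. - \<nu> A)) A" if B: "B \<in> sets M" "B \<subseteq> A" for B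
    proof -
      have "ennreal (- \<nu> (A - B)) \<le> emeasure (positive_variation M (\<lambda>A. - \<nu> A)) A"
        unfolding emeasure_positive_variation[OF vm' A] using A B by (intro SUP_upper) auto
      then have "- \<nu> (A - B) \<le> measure (positive_variation M (\<lambda>A. - \<nu> A)) A"
        by (simp add: N.emeasure_eq_measure)
      then show ?thesis using vector_measure_Diff[OF vm B(1) A B(2)] by simp
    qed
    have "0 \<le> \<nu> A + measure (positive_variation M (\<lambda>A. - \<nu> A)) A"
      using *[of "{}"] vector_measure_empty[OF vm] by simp
    moreover have "emeasure (positive_variation M \<nu>) A
        \<le> ennreal (\<nu> A + measure (positive_variation M (\<lambda>A. - \<nu> A)) A)"
      unfolding emeasure_positive_variation[OF vm A]
      by (rule SUP_least, rule ennreal_leI) (use * in auto)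
    ultimately show ?thesis by (simp add: measure_def enn2real_leI)
  qed
  show ?thesis using le[OF vm] le[OF vector_measure_uminus[OF vm]] by simp
qed

lemma norm_le_total_variation:
  assumes vm: "vector_measure M \<mu>" and A: "A \<in> sets M"
  shows "ennreal (norm (\<mu> A)) \<le> emeasure (total_variation M \<mu>) A"
proof -
  have "binaryset A {} \<in> {F. range F \<subseteq> sets M \<and> disjoint_family F \<and> (\<Union>n. F n) = A}"
    using A by (auto simp: binaryset_def disjoint_family_on_def split: if_splits)
  moreover have "(\<Sum>n. ennreal (norm (\<mu> (binaryset A {} n)))) = ennreal (norm (\<mu> A))"
    using vector_measure_empty[OF vm]
    by (subst suminf_finite[of "{0}"]) (auto simp: binaryset_def)
  ultimately show ?thesis
    unfolding emeasure_total_variation[OF vm A]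
    by (intro SUP_upper2[where i = "binaryset A {}"]) simp_all
qed

text \<open>
  The total variation is the least measure that dominates the norm. Integrals against the variation
  of images, point masses and multiples are estimated below by exhibiting a dominating measure.
\<close>

lemma total_variation_least:
  assumes vm: "vector_measure M \<mu>" and sets: "sets N = sets M"
    and le: "\<And>A. A \<in> sets M \<Longrightarrow> ennreal (norm (\<mu> A)) \<le> emeasure N A"
  shows "total_variation M \<mu> \<le> N"
proof -
  have "emeasure (total_variation M \<mu>) A \<le> emeasure N A" if A: "A \<in> sets M" for A
    unfolding emeasure_total_variation[OF vm A]
  proof (rule SUP_least, clarify)
    fix F :: "nat \<Rightarrow> 'a set" assume F: "range F \<subseteq> sets M" "disjoint_family F" "A = (\<Union>n. F n)"
    have "(\<Sum>n. ennreal (norm (\<mu> (F n)))) \<le> (\<Sum>n. emeasure N (F n))"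
      using F(1) by (intro suminf_le le) auto
    also have "\<dots> = emeasure N (\<Union>n. F n)"
      using F sets by (intro suminf_emeasure) auto
    finally show "(\<Sum>n. ennreal (norm (\<mu> (F n)))) \<le> emeasure N (\<Union>n. F n)" .
  qed
  then show ?thesis using sets by (simp add: le_measure)
qed

lemma total_variation_add_le:
  assumes vm: "vector_measure M \<mu>" "vector_measure M \<nu>" and A: "A \<in> sets M"
  shows "emeasure (total_variation M (\<lambda>A. \<mu> A + \<nu> A)) A
    \<le> emeasure (total_variation M \<mu>) A + emeasure (total_variation M \<nu>) A"
  unfolding emeasure_total_variation[OF vector_measure_add[OF vm] A]
proof (rule SUP_least, clarify)
  fix F :: "nat \<Rightarrow> 'a set" assume F: "range F \<subseteq> sets M" "disjoint_family F" "A = (\<Union>n. F n)"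
  have Fn: "F n \<in> sets M" for n using F(1) by auto
  have "(\<Sum>n. ennreal (norm (\<mu> (F n) + \<nu> (F n))))
      \<le> (\<Sum>n. emeasure (total_variation M \<mu>) (F n) + emeasure (total_variation M \<nu>) (F n))"
  proof (intro suminf_le allI)
    fix n
    have "ennreal (norm (\<mu> (F n) + \<nu> (F n))) \<le> ennreal (norm (\<mu> (F n))) + ennreal (norm (\<nu> (F n)))"
      by (simp flip: ennreal_plus add: norm_triangle_ineq)
    also have "\<dots> \<le> emeasure (total_variation M \<mu>) (F n) + emeasure (total_variation M \<nu>) (F n)"
      by (intro add_mono norm_le_total_variation vm Fn)
    finally show "ennreal (norm (\<mu> (F n) + \<nu> (F n)))
      \<le> emeasure (total_variation M \<mu>) (F n) + emeasure (total_variation M \<nu>) (F n)" .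
  qed auto
  also have "\<dots> = (\<Sum>n. emeasure (total_variation M \<mu>) (F n)) + (\<Sum>n. emeasure (total_variation M \<nu>) (F n))"
    by (rule suminf_add[symmetric]) auto
  also have "\<dots> = emeasure (total_variation M \<mu>) (\<Union>n. F n) + emeasure (total_variation M \<nu>) (\<Union>n. F n)"
    using F by (simp add: suminf_emeasure)
  finally show "(\<Sum>n. ennreal (norm (\<mu> (F n) + \<nu> (F n))))
    \<le> emeasure (total_variation M \<mu>) (\<Union>n. F n) + emeasure (total_variation M \<nu>) (\<Union>n. F n)" .
qed

text \<open>
  In finite dimension the norm is at most the sum of the absolute components, and these are dominated
  by the finite positive and negative variations.
\<close>

lemma finite_measure_total_variation:
  fixes \<mu> :: "'a set \<Rightarrow> real ^ 'm"
  assumes vm: "vector_measure M \<mu>"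
  shows "finite_measure (total_variation M \<mu>)"
proof
  define P where "P i = positive_variation M (\<lambda>A. \<mu> A $ i)" for i
  define N where "N i = positive_variation M (\<lambda>A. - \<mu> A $ i)" for i
  note vmi = vector_measure_component[OF vm]
  have P: "finite_measure (P i)" and N: "finite_measure (N i)" for i
    unfolding P_def N_def
    by (intro finite_measure_positive_variation vmi vector_measure_uminus[OF vmi])+
  have sets[simp]: "sets (P i) = sets M" "sets (N i) = sets M" for i by (simp_all add: P_def N_def)
  have comp: "ennreal \<bar>\<mu> A $ i\<bar> \<le> emeasure (P i) A + emeasure (N i) A" if A: "A \<in> sets M" for A i
  proof -
    have "\<bar>\<mu> A $ i\<bar> \<le> measure (P i) A + measure (N i) A"
      using measure_positive_variation_minus_negative[OF vmi A, of i]
        measure_nonneg[of "P i" A] measure_nonneg[of "N i" A] unfolding P_def N_def by linarith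
    then show ?thesis
      by (simp add: finite_measure.emeasure_eq_measure[OF P] finite_measure.emeasure_eq_measure[OF N]
          ennreal_leI flip: ennreal_plus)
  qed
  have le: "emeasure (total_variation M \<mu>) (space M)
      \<le> (\<Sum>i\<in>UNIV. emeasure (P i) (space M) + emeasure (N i) (space M))"
    unfolding emeasure_total_variation[OF vm sets.top]
  proof (rule SUP_least, clarify)
    fix F :: "nat \<Rightarrow> 'a set"
    assume F: "range F \<subseteq> sets M" "disjoint_family F" "(\<Union>n. F n) = space M"
    have "(\<Sum>n. ennreal (norm (\<mu> (F n)))) \<le> (\<Sum>n. \<Sum>i\<in>UNIV. emeasure (P i) (F n) + emeasure (N i) (F n))"
    proof (intro suminf_le allI)
      fix n
      have "ennreal (norm (\<mu> (F n))) \<le> ennreal (\<Sum>i\<in>UNIV. \<bar>\<mu> (F n) $ i\<bar>)"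
        by (intro ennreal_leI norm_le_l1_cart)
      also have "\<dots> = (\<Sum>i\<in>UNIV. ennreal \<bar>\<mu> (F n) $ i\<bar>)" by (rule sum_ennreal[symmetric]) simp
      also have "\<dots> \<le> (\<Sum>i\<in>UNIV. emeasure (P i) (F n) + emeasure (N i) (F n))"
        using F(1) by (intro sum_mono comp) auto
      finally show "ennreal (norm (\<mu> (F n))) \<le> (\<Sum>i\<in>UNIV. emeasure (P i) (F n) + emeasure (N i) (F n))" .
    qed auto
    also have "\<dots> = (\<Sum>i\<in>UNIV. (\<Sum>n. emeasure (P i) (F n)) + (\<Sum>n. emeasure (N i) (F n)))"
      by (simp add: suminf_sum suminf_add)
    also have "\<dots> = (\<Sum>i\<in>UNIV. emeasure (P i) (space M) + emeasure (N i) (space M))"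
      using F by (simp add: suminf_emeasure)
    finally show "(\<Sum>n. ennreal (norm (\<mu> (F n))))
        \<le> (\<Sum>i\<in>UNIV. emeasure (P i) (space M) + emeasure (N i) (space M))" .
  qed
  have "(\<Sum>i\<in>UNIV. emeasure (P i) (space M) + emeasure (N i) (space M)) < \<infinity>"
    using finite_measure.emeasure_finite[OF P] finite_measure.emeasure_finite[OF N]
    by (auto simp: less_top)
  from le_less_trans[OF le this]
  show "emeasure (total_variation M \<mu>) (space (total_variation M \<mu>)) \<noteq> \<infinity>" by simp
qed

lemma positive_variation_component_le:
  fixes \<mu> :: "'a set \<Rightarrow> real ^ 'm"
  assumes vm: "vector_measure M \<mu>"
  shows "positive_variation M (\<lambda>A. \<mu> A $ i) \<le> total_variation M \<mu>"
    and "positive_variation M (\<lambda>A. - \<mu> A $ i) \<le> total_variation M \<mu>"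
proof -
  \<comment> \<open>The factor \<open>s\<close> treats both signs at once.\<close>
  have *: "positive_variation M (\<lambda>A. s * \<mu> A $ i) \<le> total_variation M \<mu>" if s: "\<bar>s\<bar> \<le> 1" for s
  proof -
    have vms: "vector_measure M (\<lambda>A. s * \<mu> A $ i)"
      using vector_measure_component[OF vm, of i] unfolding vector_measure_def
      by (intro allI impI sums_mult) simp
    have "emeasure (positive_variation M (\<lambda>A. s * \<mu> A $ i)) A \<le> emeasure (total_variation M \<mu>) A"
      if A: "A \<in> sets M" for A
      unfolding emeasure_positive_variation[OF vms A]
    proof (rule SUP_least, clarify)
      fix B assume B: "B \<in> sets M" "B \<subseteq> A"
      have "s * \<mu> B $ i \<le> \<bar>s\<bar> * \<bar>\<mu> B $ i\<bar>" using abs_ge_self[of "s * \<mu> B $ i"] by (simp add: abs_mult)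
      also have "\<dots> \<le> 1 * norm (\<mu> B)" using s by (intro mult_mono component_le_norm_cart) auto
      finally have "ennreal (s * \<mu> B $ i) \<le> ennreal (norm (\<mu> B))" by (simp add: ennreal_leI)
      also have "\<dots> \<le> emeasure (total_variation M \<mu>) B" by (rule norm_le_total_variation[OF vm B(1)])
      also have "\<dots> \<le> emeasure (total_variation M \<mu>) A" using A B by (intro emeasure_mono) auto
      finally show "ennreal (s * \<mu> B $ i) \<le> emeasure (total_variation M \<mu>) A" .
    qed
    then show ?thesis by (simp add: le_measure)
  qed
  show "positive_variation M (\<lambda>A. \<mu> A $ i) \<le> total_variation M \<mu>"
    "positive_variation M (\<lambda>A. - \<mu> A $ i) \<le> total_variation M \<mu>"
    using *[of 1] *[of "-1"] by simp_all
qed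

lemma integrable_le_measure:
  fixes f :: "'a \<Rightarrow> 'b::{banach, second_countable_topology}"
  assumes f: "integrable N f" and "sets M = sets N" "M \<le> N"
  shows "integrable M f"
proof (rule integrableI_bounded)
  show "f \<in> borel_measurable M"
    using borel_measurable_integrable[OF f] measurable_cong_sets[OF assms(2) refl] by blast
  have "(\<integral>\<^sup>+x. ennreal (norm (f x)) \<partial>M) \<le> (\<integral>\<^sup>+x. ennreal (norm (f x)) \<partial>N)"
    by (rule nn_integral_mono_measure[OF assms(2,3)])
  also have "\<dots> < \<infinity>" using f by (simp add: integrable_iff_bounded)
  finally show "(\<integral>\<^sup>+x. ennreal (norm (f x)) \<partial>M) < \<infinity>" .
qed

text \<open>
  Subadditivity of the variation on sets carries over to integrals, since it holds in each summand
  of the integral of a simple function.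
\<close>

lemma nn_integral_le_add_measure:
  assumes sets: "sets M = sets L" "sets N = sets L"
    and le: "\<And>A. A \<in> sets L \<Longrightarrow> emeasure L A \<le> emeasure M A + emeasure N A"
  shows "(\<integral>\<^sup>+x. f x \<partial>L) \<le> (\<integral>\<^sup>+x. f x \<partial>M) + (\<integral>\<^sup>+x. f x \<partial>N)"
proof -
  have space: "space M = space L" "space N = space L"
    by (rule sets_eq_imp_space_eq[OF sets(1)], rule sets_eq_imp_space_eq[OF sets(2)])
  have simple: "simple_function M g" "simple_function N g" if "simple_function L g" for g
    using that by (simp_all add: simple_function_def sets space)
  show ?thesis unfolding nn_integral_def[of L]
  proof (rule SUP_least, clarify)
    fix g assume g: "simple_function L g" "g \<le> f"
    have "integral\<^sup>S L g \<le> (\<Sum>y\<in>g ` space L. y * (emeasure M (g -` {y} \<inter> space L) + emeasure N (g -` {y} \<inter> space L)))"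
      unfolding simple_integral_def using g(1)
      by (intro sum_mono mult_left_mono le) (auto dest: simple_functionD)
    also have "\<dots> = integral\<^sup>S M g + integral\<^sup>S N g"
      by (simp add: simple_integral_def space distrib_left sum.distrib)
    also have "\<dots> \<le> integral\<^sup>N M f + integral\<^sup>N N f"
      using g simple[OF g(1)] unfolding nn_integral_def by (intro add_mono SUP_upper) auto
    finally show "integral\<^sup>S L g \<le> integral\<^sup>N M f + integral\<^sup>N N f" .
  qed
qed

text \<open>
  The image of the total variation dominates the image measure.
\<close>

lemma nn_integral_total_variation_push_forward_le:
  fixes f :: "'c \<Rightarrow> ennreal"
  assumes vm: "vector_measure M \<mu>" and g: "g \<in> measurable M N" and f: "f \<in> borel_measurable N"
  shows "(\<integral>\<^sup>+y. f y \<partial>total_variation N (\<lambda>A. \<mu> (g -` A \<inter> space M)))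
    \<le> (\<integral>\<^sup>+x. f (g x) \<partial>total_variation M \<mu>)"
proof -
  let ?D = "distr (total_variation M \<mu>) N g"
  have g': "g \<in> measurable (total_variation M \<mu>) N"
    using g by (simp add: measurable_def)
  have "total_variation N (\<lambda>A. \<mu> (g -` A \<inter> space M)) \<le> ?D"
    using norm_le_total_variation[OF vm] measurable_sets[OF g]
    by (intro total_variation_least vector_measure_push_forward vm g) (simp_all add: emeasure_distr[OF g'])
  then have "(\<integral>\<^sup>+y. f y \<partial>total_variation N (\<lambda>A. \<mu> (g -` A \<inter> space M))) \<le> (\<integral>\<^sup>+y. f y \<partial>?D)"
    by (intro nn_integral_mono_measure) simp_all
  also have "\<dots> = (\<integral>\<^sup>+x. f (g x) \<partial>total_variation M \<mu>)"
    using f by (intro nn_integral_distr g') simp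
  finally show ?thesis .
qed

lemma vector_measure_point_mass: "vector_measure M (\<lambda>A. indicator A z *\<^sub>R v)"
  unfolding vector_measure_def
  by (intro allI impI sums_scaleR_left indicator_sums) (auto simp: disjoint_family_on_def)

lemma nn_integral_total_variation_point_mass_le:
  fixes v :: "'b::real_normed_vector" and f :: "'a \<Rightarrow> ennreal"
  assumes f: "f \<in> borel_measurable M" and z: "z \<in> space M"
  shows "(\<integral>\<^sup>+x. f x \<partial>total_variation M (\<lambda>A. indicator A z *\<^sub>R v)) \<le> ennreal (norm v) * f z"
proof -
  \<comment> \<open>The image of a one-point space is the Dirac measure at \<open>z\<close>.\<close>
  let ?D = "scale_measure (norm v) (distr (count_space {()}) M (\<lambda>_. z))"
  have z': "(\<lambda>_. z) \<in> measurable (count_space {()}) M" using z by simp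
  have "total_variation M (\<lambda>A. indicator A z *\<^sub>R v) \<le> ?D"
    by (intro total_variation_least vector_measure_point_mass)
      (auto simp: emeasure_distr[OF z'] indicator_def)
  then have "(\<integral>\<^sup>+x. f x \<partial>total_variation M (\<lambda>A. indicator A z *\<^sub>R v)) \<le> (\<integral>\<^sup>+x. f x \<partial>?D)"
    by (intro nn_integral_mono_measure) simp_all
  also have "\<dots> = ennreal (norm v) * f z"
    using f z by (simp add: nn_integral_scale_measure nn_integral_distr[OF z'] nn_integral_count_space_finite)
  finally show ?thesis .
qed

lemma vector_measure_scaleR:
  "vector_measure M \<mu> \<Longrightarrow> vector_measure M (\<lambda>A. c *\<^sub>R \<mu> A)"
  unfolding vector_measure_def by (intro allI impI sums_scaleR_right) simp

lemma nn_integral_total_variation_scaleR_le: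
  fixes \<mu> :: "'a set \<Rightarrow> 'b::real_normed_vector" and f :: "'a \<Rightarrow> ennreal"
  assumes vm: "vector_measure M \<mu>" and f: "f \<in> borel_measurable M"
  shows "(\<integral>\<^sup>+x. f x \<partial>total_variation M (\<lambda>A. c *\<^sub>R \<mu> A)) \<le> ennreal \<bar>c\<bar> * (\<integral>\<^sup>+x. f x \<partial>total_variation M \<mu>)"
proof -
  have "total_variation M (\<lambda>A. c *\<^sub>R \<mu> A) \<le> scale_measure \<bar>c\<bar> (total_variation M \<mu>)"
    using norm_le_total_variation[OF vm]
    by (intro total_variation_least vector_measure_scaleR vm) (simp_all add: ennreal_mult mult_left_mono)
  then have "(\<integral>\<^sup>+x. f x \<partial>total_variation M (\<lambda>A. c *\<^sub>R \<mu> A))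
      \<le> (\<integral>\<^sup>+x. f x \<partial>scale_measure \<bar>c\<bar> (total_variation M \<mu>))"
    by (intro nn_integral_mono_measure) simp_all
  also have "\<dots> = ennreal \<bar>c\<bar> * (\<integral>\<^sup>+x. f x \<partial>total_variation M \<mu>)"
    using f by (intro nn_integral_scale_measure) simp
  finally show "(\<integral>\<^sup>+x. f x \<partial>total_variation M (\<lambda>A. c *\<^sub>R \<mu> A)) \<le> ennreal \<bar>c\<bar> * (\<integral>\<^sup>+x. f x \<partial>total_variation M \<mu>)" .
qed

section \<open>Integration against a vector measure\<close>

lemma integral_simple_function_eq_sum:
  fixes k :: "'c \<Rightarrow> real"
  assumes "finite_measure N" and f: "simple_function N f"
  shows "(\<integral>x. k (f x) \<partial>N) = (\<Sum>y\<in>f ` space N. k y * measure N (f -` {y} \<inter> space N))"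
proof -
  interpret finite_measure N by fact
  have eq: "k (f x) = (\<Sum>y\<in>f ` space N. k y * indicator (f -` {y} \<inter> space N) x)" if "x \<in> space N" for x
    using that simple_functionD(1)[OF f]
    by (subst sum.remove[of _ "f x"]) (auto simp: indicator_def intro!: sum.neutral)
  have sets: "f -` {y} \<inter> space N \<in> sets N" for y using simple_functionD(2)[OF f] .
  have "(\<integral>x. k (f x) \<partial>N) = (\<integral>x. (\<Sum>y\<in>f ` space N. k y * indicator (f -` {y} \<inter> space N) x) \<partial>N)"
    by (intro Bochner_Integration.integral_cong refl eq)
  also have "\<dots> = (\<Sum>y\<in>f ` space N. k y * measure N (f -` {y} \<inter> space N))"
    using sets by (subst Bochner_Integration.integral_sum) (auto simp: less_top[symmetric])
  finally show ?thesis .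
qed

text \<open>
  The integrand is written as \<open>h \<circ> f\<close> with a simple \<open>f\<close> into an arbitrary type. Below this is used with a
  Lipschitz function \<open>h\<close> and a simple map \<open>f\<close> of the underlying space into itself.
\<close>

lemma inner_integral_simple:
  fixes \<mu> :: "'a set \<Rightarrow> real ^ 'm" and h :: "'c \<Rightarrow> real ^ 'm"
  assumes vm: "vector_measure M \<mu>" and f: "simple_function M f"
  shows "inner_integral M \<mu> (\<lambda>x. h (f x)) = (\<Sum>y\<in>f ` space M. h y \<bullet> \<mu> (f -` {y} \<inter> space M))"
proof -
  have simple: "simple_function (positive_variation M \<nu>) f" for \<nu>
    using f by (simp add: simple_function_def)
  have "signed_integral M (\<lambda>A. \<mu> A $ i) (\<lambda>x. h (f x) $ i)
      = (\<Sum>y\<in>f ` space M. h y $ i * \<mu> (f -` {y} \<inter> space M) $ i)" for i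
  proof -
    note vmi = vector_measure_component[OF vm, of i]
    show ?thesis
      unfolding signed_integral_def
      using simple_functionD(2)[OF f]
      by (subst (1 2) integral_simple_function_eq_sum[where k="\<lambda>y. h y $ i"])
        (simp_all add: simple finite_measure_positive_variation vmi vector_measure_uminus[OF vmi]
          measure_positive_variation_minus_negative[OF vmi]
          flip: sum_subtractf right_diff_distrib)
  qed
  then have "inner_integral M \<mu> (\<lambda>x. h (f x))
      = (\<Sum>i\<in>UNIV. \<Sum>y\<in>f ` space M. h y $ i * \<mu> (f -` {y} \<inter> space M) $ i)"
    by (simp add: inner_integral_def)
  also have "\<dots> = (\<Sum>y\<in>f ` space M. h y \<bullet> \<mu> (f -` {y} \<inter> space M))"
    by (subst sum.swap) (simp add: inner_vec_def)
  finally show ?thesis .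
qed

lemma integrable_component:
  fixes f :: "'a \<Rightarrow> real ^ 'm"
  assumes vm: "vector_measure M \<mu>" and f: "integrable (total_variation M \<mu>) f"
  shows "integrable (positive_variation M (\<lambda>A. \<mu> A $ i)) (\<lambda>x. f x $ j)"
    and "integrable (positive_variation M (\<lambda>A. - \<mu> A $ i)) (\<lambda>x. f x $ j)"
proof -
  have "integrable (total_variation M \<mu>) (\<lambda>x. f x $ j)"
    using integrable_bounded_linear[OF bounded_linear_vec_nth f] .
  then show "integrable (positive_variation M (\<lambda>A. \<mu> A $ i)) (\<lambda>x. f x $ j)"
    "integrable (positive_variation M (\<lambda>A. - \<mu> A $ i)) (\<lambda>x. f x $ j)"
    by (rule integrable_le_measure; simp add: positive_variation_component_le[OF vm])+
qed

lemma inner_integral_diff: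
  assumes vm: "vector_measure M \<mu>"
    and "integrable (total_variation M \<mu>) f" "integrable (total_variation M \<mu>) g"
  shows "inner_integral M \<mu> (\<lambda>x. f x - g x) = inner_integral M \<mu> f - inner_integral M \<mu> g"
  by (simp add: inner_integral_def signed_integral_def integrable_component[OF vm] assms
      Bochner_Integration.integral_diff sum_subtractf)

lemma inner_integral_dominated_convergence:
  fixes \<mu> :: "'a set \<Rightarrow> real ^ 'm"
  assumes vm: "vector_measure M \<mu>"
    and f: "f \<in> borel_measurable M" and s: "\<And>n. s n \<in> borel_measurable M"
    and g: "integrable (total_variation M \<mu>) g"
    and lim: "\<And>x. x \<in> space M \<Longrightarrow> (\<lambda>n. s n x) \<longlonglongrightarrow> f x"
    and bound: "\<And>n x. x \<in> space M \<Longrightarrow> norm (s n x) \<le> g x"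
  shows "(\<lambda>n. inner_integral M \<mu> (s n)) \<longlonglongrightarrow> inner_integral M \<mu> f"
proof -
  have *: "(\<lambda>n. \<integral>x. s n x $ i \<partial>N) \<longlonglongrightarrow> (\<integral>x. f x $ i \<partial>N)"
    if N: "sets N = sets M" "N \<le> total_variation M \<mu>" for N i
  proof (rule integral_dominated_convergence[where w = g])
    have [simp]: "space N = space M" by (rule sets_eq_imp_space_eq[OF N(1)])
    have meas: "(\<lambda>x. h x $ i) \<in> borel_measurable N" if "h \<in> borel_measurable M" for h :: "'a \<Rightarrow> real ^ 'm"
    proof -
      have "h \<in> borel_measurable N" using that measurable_cong_sets[OF N(1) refl] by blast
      moreover have "(\<lambda>v::real ^ 'm. v $ i) \<in> borel_measurable borel"
        by (intro borel_measurable_continuous_onI continuous_intros)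
      ultimately show ?thesis by (rule measurable_compose)
    qed
    show "(\<lambda>x. f x $ i) \<in> borel_measurable N" "(\<lambda>x. s n x $ i) \<in> borel_measurable N" for n
      by (intro meas f s)+
    show "integrable N g" by (rule integrable_le_measure[OF g]) (use N in auto)
    show "AE x in N. (\<lambda>n. s n x $ i) \<longlonglongrightarrow> f x $ i"
      using lim by (intro AE_I2 tendsto_vec_nth) simp
    show "AE x in N. norm (s n x $ i) \<le> g x" for n
      using order_trans[OF component_le_norm_cart bound] by (intro AE_I2) simp
  qed
  show ?thesis
    unfolding inner_integral_def signed_integral_def
    by (intro tendsto_sum tendsto_diff * positive_variation_component_le[OF vm]) simp_all
qed

text \<open>
  For a simple function this is the Cauchy-Schwarz inequality in each term together with
  \<open>\<parallel>\<mu> A\<parallel> \<le> \<parallel>\<mu>\<parallel>(A)\<close>. The general case follows by dominated convergence on both sides.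
\<close>

lemma inner_integral_le:
  fixes \<mu> :: "'a set \<Rightarrow> real ^ 'm"
  assumes vm: "vector_measure M \<mu>" and f: "integrable (total_variation M \<mu>) f"
  shows "inner_integral M \<mu> f \<le> (\<integral>x. norm (f x) \<partial>total_variation M \<mu>)"
proof -
  interpret finite_measure "total_variation M \<mu>" by (rule finite_measure_total_variation[OF vm])
  have meas: "f \<in> borel_measurable M"
    using borel_measurable_integrable[OF f] by simp
  obtain s where s: "\<And>n. simple_function M (s n)"
      "\<And>x. x \<in> space M \<Longrightarrow> (\<lambda>n. s n x) \<longlonglongrightarrow> f x"
      "\<And>n x. x \<in> space M \<Longrightarrow> norm (s n x) \<le> 2 * norm (f x)"
    using borel_measurable_implies_sequence_metric[OF meas, of 0] by simp metis
  have int: "integrable (total_variation M \<mu>) (\<lambda>x. 2 * norm (f x))" using f by simp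
  have sM: "s n \<in> borel_measurable M" for n by (rule borel_measurable_simple_function[OF s(1)])
  have "(\<lambda>n. inner_integral M \<mu> (s n)) \<longlonglongrightarrow> inner_integral M \<mu> f"
    by (rule inner_integral_dominated_convergence[OF vm meas sM int s(2,3)])
  moreover have "(\<lambda>n. \<integral>x. norm (s n x) \<partial>total_variation M \<mu>) \<longlonglongrightarrow> (\<integral>x. norm (f x) \<partial>total_variation M \<mu>)"
    using s(2,3) meas sM
    by (intro integral_dominated_convergence[OF _ _ int]) (auto intro!: tendsto_norm)
  moreover have "inner_integral M \<mu> (s n) \<le> (\<integral>x. norm (s n x) \<partial>total_variation M \<mu>)" for n
  proof -
    have "s n -` {y} \<inter> space M \<in> sets M" for y by (rule simple_functionD(2)[OF s(1)])
    then have "norm (\<mu> (s n -` {y} \<inter> space M)) \<le> measure (total_variation M \<mu>) (s n -` {y} \<inter> space M)" for y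
      using norm_le_total_variation[OF vm] by (simp add: emeasure_eq_measure)
    then have "y \<bullet> \<mu> (s n -` {y} \<inter> space M)
        \<le> norm y * measure (total_variation M \<mu>) (s n -` {y} \<inter> space M)" for y
      by (meson norm_cauchy_schwarz mult_left_mono norm_ge_zero order_trans)
    then show ?thesis
      using inner_integral_simple[OF vm s(1), of "\<lambda>y. y" n]
        integral_simple_function_eq_sum[OF finite_measure_axioms, of "s n" norm] s(1)[of n]
      by (simp add: simple_function_def sum_mono)
  qed
  ultimately show ?thesis by (intro LIMSEQ_le) auto
qed

section \<open>Measures with finite first moment\<close>

definition transport_cost :: "(('a::metric_space \<times> 'a) set \<Rightarrow> real ^ 'm) \<Rightarrow> ennreal" where
  "transport_cost \<pi> = (\<integral>\<^sup>+ z. ennreal (dist (fst z) (snd z)) \<partial>total_variation borel \<pi>)"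

lemma borel_measurable_dist_fst_snd:
  "(\<lambda>z. ennreal (dist (fst z) (snd z))) \<in>
     borel_measurable (borel :: ('a::{metric_space, second_countable_topology} \<times> 'a) measure)"
  by (intro measurable_compose[OF borel_measurable_continuous_onI measurable_ennreal] continuous_intros)

lemma borel_measurable_dist_point:
  "(\<lambda>x. ennreal (dist x x0)) \<in> borel_measurable (borel :: 'a::metric_space measure)"
  by (intro measurable_compose[OF borel_measurable_continuous_onI measurable_ennreal] continuous_intros)

lemma borel_measurable_fst_snd:
  "fst \<in> borel_measurable (borel :: ('a::topological_space \<times> 'b::topological_space) measure)"
  "snd \<in> borel_measurable (borel :: ('a::topological_space \<times> 'b::topological_space) measure)"
  by (intro borel_measurable_continuous_onI continuous_intros)+

lemma wasserstein_space_vector_measure: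
  "\<mu> \<in> wasserstein_space \<Longrightarrow> vector_measure borel \<mu>"
  by (simp add: wasserstein_space_def)

text \<open>
  Finiteness of the first moment does not depend on the base point, because the measure is finite and
  the two distances differ by at most a constant.
\<close>

lemma nn_integral_dist_change_point:
  fixes x0 x1 :: "'a::metric_space"
  assumes "finite_measure N" "sets N = sets borel"
    and "(\<integral>\<^sup>+x. ennreal (dist x x0) \<partial>N) < \<infinity>"
  shows "(\<integral>\<^sup>+x. ennreal (dist x x1) \<partial>N) < \<infinity>"
proof -
  have meas: "(\<lambda>x. ennreal (dist x x0)) \<in> borel_measurable N"
    unfolding measurable_cong_sets[OF assms(2) refl] by (rule borel_measurable_dist_point)
  have "(\<integral>\<^sup>+x. ennreal (dist x x1) \<partial>N) \<le> (\<integral>\<^sup>+x. ennreal (dist x x0) + ennreal (dist x0 x1) \<partial>N)"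
    by (intro nn_integral_mono) (simp flip: ennreal_plus add: dist_triangle)
  also have "\<dots> = (\<integral>\<^sup>+x. ennreal (dist x x0) \<partial>N) + (\<integral>\<^sup>+x. ennreal (dist x0 x1) \<partial>N)"
    using meas by (intro nn_integral_add) simp_all
  also have "\<dots> < \<infinity>"
    using assms(3) finite_measure.emeasure_finite[OF assms(1)]
    by (simp add: ennreal_mult_less_top less_top)
  finally show ?thesis .
qed

lemma wasserstein_space_moment:
  assumes "\<mu> \<in> wasserstein_space"
  shows "(\<integral>\<^sup>+x. ennreal (dist x x1) \<partial>total_variation borel \<mu>) < \<infinity>"
proof -
  obtain x0 where "(\<integral>\<^sup>+x. ennreal (dist x x0) \<partial>total_variation borel \<mu>) < \<infinity>"
    using assms by (auto simp: wasserstein_space_def)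
  then show ?thesis
    by (rule nn_integral_dist_change_point[rotated 2])
      (simp_all add: finite_measure_total_variation wasserstein_space_vector_measure[OF assms])
qed

lemma wasserstein_space_integrable_dist:
  assumes "\<mu> \<in> wasserstein_space"
  shows "integrable (total_variation borel \<mu>) (\<lambda>x. dist x x0)"
proof (rule integrableI_bounded)
  show "(\<lambda>x. dist x x0) \<in> borel_measurable (total_variation borel \<mu>)"
    using borel_measurable_continuous_onI[of "\<lambda>x. dist x x0"] by (simp add: continuous_on_dist)
  show "(\<integral>\<^sup>+x. ennreal (norm (dist x x0)) \<partial>total_variation borel \<mu>) < \<infinity>"
    using wasserstein_space_moment[OF assms] by simp
qed

lemma lipschitz_integrable:
  fixes u :: "'a::metric_space \<Rightarrow> real ^ 'm"
  assumes \<mu>: "\<mu> \<in> wasserstein_space" and u: "1-lipschitz_on UNIV u"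
  shows "u \<in> borel_measurable borel" and "integrable (total_variation borel \<mu>) u"
proof -
  show meas: "u \<in> borel_measurable borel"
    by (intro borel_measurable_continuous_onI lipschitz_on_continuous_on[OF u])
  interpret finite_measure "total_variation borel \<mu>"
    by (intro finite_measure_total_variation wasserstein_space_vector_measure \<mu>)
  \<comment> \<open>The element \<^term>\<open>undefined\<close> serves as an arbitrary base point.\<close>
  have "integrable (total_variation borel \<mu>) (\<lambda>x. norm (u undefined) + dist x undefined)"
    by (intro Bochner_Integration.integrable_add wasserstein_space_integrable_dist[OF \<mu>]) simp
  then show "integrable (total_variation borel \<mu>) u"
  proof (rule Bochner_Integration.integrable_bound)
    show "AE x in total_variation borel \<mu>. norm (u x) \<le> norm (norm (u undefined) + dist x undefined)"
    proof (rule AE_I2)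
      fix x
      have "norm (u x) \<le> norm (u undefined) + norm (u x - u undefined)" by (rule norm_triangle_sub)
      also have "norm (u x - u undefined) \<le> dist x undefined"
        using lipschitz_onD[OF u, of x undefined] by (simp add: dist_norm)
      finally show "norm (u x) \<le> norm (norm (u undefined) + dist x undefined)" by simp
    qed
  qed (use meas in simp)
qed

section \<open>Weak duality\<close>

text \<open>
  The marginal condition is an identity between set functions, hence an identity of integrals of
  simple functions. The integrand is assumed to be bounded because the marginals of \<open>\<pi>\<close> need not have
  finite first moments even though \<open>\<mu>\<close> does: a Lipschitz function composed with a projection
  may fail to be integrable against \<open>\<pi>\<close>.
\<close>

lemma inner_integral_transport:
  fixes \<mu> :: "'a::metric_space set \<Rightarrow> real ^ 'm"
  assumes vm: "vector_measure borel \<mu>" and \<pi>: "\<pi> \<in> transports \<mu>"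
    and u: "u \<in> borel_measurable borel" and bdd: "\<And>x. norm (u x) \<le> C"
  shows "inner_integral borel \<mu> u = inner_integral borel \<pi> (\<lambda>z. u (fst z) - u (snd z))"
proof -
  have vm\<pi>: "vector_measure borel \<pi>" using \<pi> by (simp add: transports_def)
  interpret M: finite_measure "total_variation borel \<mu>" by (rule finite_measure_total_variation[OF vm])
  interpret P: finite_measure "total_variation borel \<pi>" by (rule finite_measure_total_variation[OF vm\<pi>])
  obtain s where s: "\<And>n. simple_function borel (s n)"
      "\<And>x. (\<lambda>n. s n x) \<longlonglongrightarrow> u x" "\<And>n x. norm (s n x) \<le> 2 * norm (u x)"
    using borel_measurable_implies_sequence_metric[OF u, of 0] by simp metis
  have bdd_s: "norm (s n x) \<le> 2 * C" for n x using s(3)[of n x] bdd[of x] by simp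
  have meas: "s n \<in> borel_measurable borel" for n by (rule borel_measurable_simple_function[OF s(1)])
  have compose: "simple_function borel (\<lambda>z. s n (g z))" if "g \<in> borel_measurable borel" for g :: "'a \<times> 'a \<Rightarrow> 'a" and n
    using simple_function_comp[OF that, of "s n"] s(1)[of n] by (simp add: comp_def)
  note simple = compose[OF borel_measurable_fst_snd(1)] compose[OF borel_measurable_fst_snd(2)]
  have int: "integrable (total_variation borel \<pi>) (\<lambda>z. s n (g z))" if g: "g \<in> borel_measurable borel" for g :: "'a \<times> 'a \<Rightarrow> 'a" and n
    using measurable_compose[OF g meas] bdd_s
    by (intro P.integrable_const_bound[where B = "2 * C"]) auto
  have eq: "inner_integral borel \<mu> (s n) = inner_integral borel \<pi> (\<lambda>z. s n (fst z) - s n (snd z))" for n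
  proof -
    have range: "range (\<lambda>z::'a \<times> 'a. s n (fst z)) = range (s n)" "range (\<lambda>z::'a \<times> 'a. s n (snd z)) = range (s n)"
      by (auto simp: image_def)
    have vimage: "(\<lambda>z::'a \<times> 'a. s n (fst z)) -` {y} = (s n -` {y}) \<times> UNIV"
      "(\<lambda>z::'a \<times> 'a. s n (snd z)) -` {y} = UNIV \<times> (s n -` {y})" for y by auto
    have "s n -` {y} \<in> sets borel" for y using simple_functionD(2)[OF s(1), of n "{y}"] by simp
    then have marg: "\<mu> (s n -` {y}) = \<pi> ((s n -` {y}) \<times> UNIV) - \<pi> (UNIV \<times> (s n -` {y}))" for y
      using \<pi> by (simp add: transports_def marginal1_def marginal2_def)
    have "inner_integral borel \<pi> (\<lambda>z. s n (fst z) - s n (snd z))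
        = inner_integral borel \<pi> (\<lambda>z. s n (fst z)) - inner_integral borel \<pi> (\<lambda>z. s n (snd z))"
      by (intro inner_integral_diff vm\<pi> int borel_measurable_fst_snd)
    also have "\<dots> = (\<Sum>y\<in>range (s n). y \<bullet> \<pi> ((s n -` {y}) \<times> UNIV)) - (\<Sum>y\<in>range (s n). y \<bullet> \<pi> (UNIV \<times> (s n -` {y})))"
      using inner_integral_simple[OF vm\<pi> simple(1), of "\<lambda>y. y" n]
        inner_integral_simple[OF vm\<pi> simple(2), of "\<lambda>y. y" n] by (simp add: range vimage)
    also have "\<dots> = (\<Sum>y\<in>range (s n). y \<bullet> \<mu> (s n -` {y}))"
      by (simp add: marg inner_diff_right sum_subtractf)
    also have "\<dots> = inner_integral borel \<mu> (s n)"
      using inner_integral_simple[OF vm s(1), of "\<lambda>y. y" n] by simp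
    finally show ?thesis ..
  qed
  have "(\<lambda>n. inner_integral borel \<mu> (s n)) \<longlonglongrightarrow> inner_integral borel \<mu> u"
    by (rule inner_integral_dominated_convergence[OF vm u meas, of "\<lambda>_. 2 * C"]) (simp_all add: s(2) bdd_s)
  moreover have "(\<lambda>n. inner_integral borel \<pi> (\<lambda>z. s n (fst z) - s n (snd z)))
      \<longlonglongrightarrow> inner_integral borel \<pi> (\<lambda>z. u (fst z) - u (snd z))"
  proof (rule inner_integral_dominated_convergence[OF vm\<pi>, of _ _ "\<lambda>_. 4 * C"])
    show "(\<lambda>z. u (fst z) - u (snd z)) \<in> borel_measurable borel"
      by (intro borel_measurable_diff measurable_compose[OF _ u] borel_measurable_fst_snd)
    show "(\<lambda>z. s n (fst z) - s n (snd z)) \<in> borel_measurable borel" for n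
      by (intro borel_measurable_diff measurable_compose[OF _ meas] borel_measurable_fst_snd)
    show "norm (s n (fst z) - s n (snd z)) \<le> 4 * C" for n z
      using norm_triangle_ineq4[of "s n (fst z)" "s n (snd z)"] bdd_s[of n "fst z"] bdd_s[of n "snd z"] by simp
  qed (auto intro!: tendsto_diff s(2))
  ultimately show ?thesis unfolding eq by (rule LIMSEQ_unique)
qed

text \<open>
  For bounded \<open>u\<close> the integral of \<open>\<langle>u, d\<mu>\<rangle>\<close> is that of \<open>\<langle>u x - u y, d\<pi>\<rangle>\<close>, which is at most the cost since
  \<open>\<parallel>u x - u y\<parallel> \<le> dist x y\<close>. An unbounded \<open>u\<close> is first truncated by the nearest-point projection onto a
  ball of radius \<open>n\<close>; the projection does not increase distances, so the truncations are still
  1-Lipschitz, and they converge to \<open>u\<close> with \<open>\<parallel>u\<parallel>\<close> as a dominating function.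
\<close>

lemma weak_duality:
  fixes \<mu> :: "'a::metric_space set \<Rightarrow> real ^ 'm"
  assumes \<mu>: "\<mu> \<in> wasserstein_space" and \<pi>: "\<pi> \<in> transports \<mu>" and u: "1-lipschitz_on UNIV u"
  shows "ennreal (inner_integral borel \<mu> u) \<le> transport_cost \<pi>"
proof -
  note vm = wasserstein_space_vector_measure[OF \<mu>]
  have vm\<pi>: "vector_measure borel \<pi>" using \<pi> by (simp add: transports_def)
  interpret P: finite_measure "total_variation borel \<pi>" by (rule finite_measure_total_variation[OF vm\<pi>])
  define v where "v n x = closest_point (cball 0 (real n)) (u x)" for n x
  have ball: "convex (cball (0::real ^ 'm) (real n))" "closed (cball (0::real ^ 'm) (real n))"
    "cball (0::real ^ 'm) (real n) \<noteq> {}" for n by auto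
  have v_lip: "1-lipschitz_on UNIV (v n)" for n
  proof (rule lipschitz_onI)
    show "dist (v n x) (v n y) \<le> 1 * dist x y" for x y
      using closest_point_lipschitz[OF ball, of n "u x" "u y"] lipschitz_onD[OF u, of x y] by (simp add: v_def)
  qed simp
  have v_bdd: "norm (v n x) \<le> real n" for n x
    using closest_point_in_set[OF ball(2,3), of n "u x"] by (simp add: v_def)
  have v_le: "norm (v n x) \<le> norm (u x)" for n x
    using closest_point_lipschitz[OF ball, of n "u x" 0] closest_point_self[of 0 "cball (0::real ^ 'm) (real n)"]
    by (simp add: v_def)
  have v_lim: "(\<lambda>n. v n x) \<longlonglongrightarrow> u x" for x
  proof (rule tendsto_eventually)
    have "v n x = u x" if "n \<ge> nat \<lceil>norm (u x)\<rceil>" for n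
    proof -
      have "u x \<in> cball 0 (real n)" using that by (simp add: nat_le_iff ceiling_le_iff)
      then show ?thesis unfolding v_def by (rule closest_point_self)
    qed
    then show "\<forall>\<^sub>F n in sequentially. v n x = u x" unfolding eventually_sequentially by blast
  qed
  have v_meas: "v n \<in> borel_measurable borel" for n by (rule lipschitz_integrable(1)[OF \<mu> v_lip])
  have "(\<lambda>n. inner_integral borel \<mu> (v n)) \<longlonglongrightarrow> inner_integral borel \<mu> u"
    by (rule inner_integral_dominated_convergence[OF vm lipschitz_integrable(1)[OF \<mu> u] v_meas
          integrable_norm[OF lipschitz_integrable(2)[OF \<mu> u]]]) (simp_all add: v_lim v_le)
  then have "(\<lambda>n. ennreal (inner_integral borel \<mu> (v n))) \<longlonglongrightarrow> ennreal (inner_integral borel \<mu> u)"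
    by (rule tendsto_ennrealI)
  moreover have "ennreal (inner_integral borel \<mu> (v n)) \<le> transport_cost \<pi>" for n
  proof -
    let ?w = "\<lambda>z. v n (fst z) - v n (snd z)"
    have meas: "?w \<in> borel_measurable borel"
      by (intro borel_measurable_diff measurable_compose[OF _ v_meas] borel_measurable_fst_snd)
    have int: "integrable (total_variation borel \<pi>) ?w"
    proof (rule P.integrable_const_bound[where B = "2 * real n"])
      have "norm (?w z) \<le> 2 * real n" for z
        using norm_triangle_ineq4[of "v n (fst z)" "v n (snd z)"] v_bdd[of n "fst z"] v_bdd[of n "snd z"] by simp
      then show "AE z in total_variation borel \<pi>. norm (?w z) \<le> 2 * real n" by simp
    qed (use meas in simp)
    have "ennreal (inner_integral borel \<mu> (v n)) = ennreal (inner_integral borel \<pi> ?w)"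
      using inner_integral_transport[OF vm \<pi> v_meas v_bdd] by simp
    also have "\<dots> \<le> ennreal (\<integral>z. norm (?w z) \<partial>total_variation borel \<pi>)"
      by (intro ennreal_leI inner_integral_le vm\<pi> int)
    also have "\<dots> = (\<integral>\<^sup>+z. ennreal (norm (?w z)) \<partial>total_variation borel \<pi>)"
      by (rule nn_integral_eq_integral[symmetric]) (use int in auto)
    also have "\<dots> \<le> transport_cost \<pi>"
      unfolding transport_cost_def
      using lipschitz_onD[OF v_lip] by (intro nn_integral_mono ennreal_leI) (simp add: dist_norm)
    finally show ?thesis .
  qed
  ultimately show ?thesis by (intro LIMSEQ_le_const2) auto
qed

section \<open>The Wasserstein seminorm\<close>

text \<open>
  Measures are functions on sets, so that pointwise operations make the Wasserstein space a linear
  subspace of a real vector space of functions, to which the Hahn-Banach theorem applies.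
\<close>

instantiation "fun" :: (type, real_vector) real_vector
begin

definition scaleR_fun :: "real \<Rightarrow> ('a \<Rightarrow> 'b) \<Rightarrow> 'a \<Rightarrow> 'b" where
  "scaleR_fun c f = (\<lambda>x. c *\<^sub>R f x)"

instance
  by standard (simp_all add: fun_eq_iff scaleR_fun_def algebra_simps)

end

lemma transport_cost_add_le:
  fixes \<pi> \<rho> :: "('a::metric_space \<times> 'a) set \<Rightarrow> real ^ 'm"
  assumes "vector_measure borel \<pi>" "vector_measure borel \<rho>"
  shows "transport_cost (\<pi> + \<rho>) \<le> transport_cost \<pi> + transport_cost \<rho>"
  unfolding transport_cost_def plus_fun_def
  by (rule nn_integral_le_add_measure) (simp_all add: total_variation_add_le assms)

lemma wasserstein_norm_le: "\<pi> \<in> transports \<mu> \<Longrightarrow> wasserstein_norm \<mu> \<le> transport_cost \<pi>"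
  unfolding wasserstein_norm_def transport_cost_def by (rule INF_lower)

text \<open>
  Moving the mass of \<open>\<mu>\<close> along a Borel map \<open>T\<close>: the image of \<open>\<mu>\<close> under \<open>x \<mapsto> (x, T x)\<close>
  transports \<open>\<mu>\<close> to its image under \<open>T\<close>.
\<close>

lemma map_transport:
  fixes \<mu> :: "'a::{metric_space, second_countable_topology} set \<Rightarrow> real ^ 'm"
  assumes vm: "vector_measure borel \<mu>" and T: "T \<in> borel_measurable borel"
  defines "\<pi> \<equiv> \<lambda>A. \<mu> ((\<lambda>x. (x, T x)) -` A)"
  shows "vector_measure borel \<pi>" "marginal1 \<pi> = \<mu>" "marginal2 \<pi> = (\<lambda>A. \<mu> (T -` A))"
    and "transport_cost \<pi> \<le> (\<integral>\<^sup>+x. ennreal (dist x (T x)) \<partial>total_variation borel \<mu>)"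
proof -
  have meas: "(\<lambda>x. (x, T x)) \<in> borel_measurable borel"
    using T by (intro borel_measurable_Pair) auto
  show "vector_measure borel \<pi>"
    using vector_measure_push_forward[OF vm meas] by (simp add: \<pi>_def)
  show "marginal1 \<pi> = \<mu>" "marginal2 \<pi> = (\<lambda>A. \<mu> (T -` A))"
    by (auto simp: fun_eq_iff marginal1_def marginal2_def \<pi>_def vimage_def)
  show "transport_cost \<pi> \<le> (\<integral>\<^sup>+x. ennreal (dist x (T x)) \<partial>total_variation borel \<mu>)"
    using nn_integral_total_variation_push_forward_le[OF vm meas borel_measurable_dist_fst_snd]
    by (simp add: transport_cost_def \<pi>_def)
qed

text \<open>
  Since \<open>\<mu>\<close> has total mass zero, moving everything to one point cancels it, at the cost of the first
  moment.
\<close>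

lemma wasserstein_norm_finite:
  fixes \<mu> :: "'a::{metric_space, second_countable_topology} set \<Rightarrow> real ^ 'm"
  assumes \<mu>: "\<mu> \<in> wasserstein_space"
  shows "wasserstein_norm \<mu> < \<infinity>"
proof -
  have vm: "vector_measure borel \<mu>" and "\<mu> UNIV = 0" using \<mu> by (auto simp: wasserstein_space_def)
  have meas: "(\<lambda>_. undefined) \<in> borel_measurable (borel :: 'a measure)" by simp
  have "\<mu> ((\<lambda>_. undefined) -` A) = 0" for A :: "'a set"
    using \<open>\<mu> UNIV = 0\<close> vector_measure_empty[OF vm] by (cases "undefined \<in> A") (simp_all add: vimage_def)
  then have "(\<lambda>A. \<mu> ((\<lambda>x. (x, undefined)) -` A)) \<in> transports \<mu>"
    using map_transport(1-3)[OF vm meas] by (simp add: transports_def)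
  then have "wasserstein_norm \<mu> \<le> transport_cost (\<lambda>A. \<mu> ((\<lambda>x. (x, undefined)) -` A))"
    by (rule wasserstein_norm_le)
  also have "\<dots> \<le> (\<integral>\<^sup>+x. ennreal (dist x undefined) \<partial>total_variation borel \<mu>)"
    by (rule map_transport(4)[OF vm meas])
  also have "\<dots> < \<infinity>" by (rule wasserstein_space_moment[OF \<mu>])
  finally show ?thesis .
qed

lemma subspace_wasserstein_space:
  "subspace (wasserstein_space :: ('a::metric_space set \<Rightarrow> real ^ 'm) set)"
proof (rule subspaceI)
  fix \<mu> \<nu> :: "'a set \<Rightarrow> real ^ 'm" and c :: real
  have "vector_measure borel (\<lambda>_ :: 'a set. 0 :: real ^ 'm)"
    and "(\<integral>\<^sup>+x. ennreal (dist x undefined) \<partial>total_variation borel (\<lambda>_ :: 'a set. 0 :: real ^ 'm)) \<le> 0"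
    using vector_measure_point_mass[of borel "undefined :: 'a" "0 :: real ^ 'm"]
      nn_integral_total_variation_point_mass_le[OF borel_measurable_dist_point[of undefined],
        of undefined "0 :: real ^ 'm"] by simp_all
  then show "(0 :: 'a set \<Rightarrow> real ^ 'm) \<in> wasserstein_space"
    by (auto simp: wasserstein_space_def zero_fun_def intro!: exI[of _ undefined])
  {
    assume \<mu>: "\<mu> \<in> wasserstein_space" and \<nu>: "\<nu> \<in> wasserstein_space"
    note vm = wasserstein_space_vector_measure[OF \<mu>] wasserstein_space_vector_measure[OF \<nu>]
    have "(\<integral>\<^sup>+x. ennreal (dist x undefined) \<partial>total_variation borel (\<lambda>A. \<mu> A + \<nu> A))
        \<le> (\<integral>\<^sup>+x. ennreal (dist x undefined) \<partial>total_variation borel \<mu>)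
          + (\<integral>\<^sup>+x. ennreal (dist x undefined) \<partial>total_variation borel \<nu>)"
      by (rule nn_integral_le_add_measure) (simp_all add: total_variation_add_le vm)
    also have "\<dots> < \<infinity>"
      using wasserstein_space_moment[OF \<mu>] wasserstein_space_moment[OF \<nu>] by simp
    finally show "\<mu> + \<nu> \<in> wasserstein_space"
      using \<mu> \<nu> vector_measure_add[OF vm] by (auto simp: wasserstein_space_def plus_fun_def)
  }
  {
    assume \<mu>: "\<mu> \<in> wasserstein_space"
    note le = nn_integral_total_variation_scaleR_le[OF wasserstein_space_vector_measure[OF \<mu>]
        borel_measurable_dist_point[of undefined], of c]
    have "(\<integral>\<^sup>+x. ennreal (dist x undefined) \<partial>total_variation borel (\<lambda>A. c *\<^sub>R \<mu> A)) < \<infinity>"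
      using wasserstein_space_moment[OF \<mu>, of undefined]
      by (intro le_less_trans[OF le]) (simp add: ennreal_mult_less_top)
    then show "c *\<^sub>R \<mu> \<in> wasserstein_space"
      using \<mu> vector_measure_scaleR[OF wasserstein_space_vector_measure[OF \<mu>]]
      by (auto simp: wasserstein_space_def scaleR_fun_def)
  }
qed

text \<open>
  Within the Wasserstein space the norm is finite, which allows the seminorm estimates to be done in
  the reals, with transports that are optimal up to \<open>e\<close>.
\<close>

lemma wasserstein_norm_approx:
  fixes \<mu> :: "'a::{metric_space, second_countable_topology} set \<Rightarrow> real ^ 'm"
  assumes "\<mu> \<in> wasserstein_space" "e > 0"
  obtains \<pi> where "\<pi> \<in> transports \<mu>" "vector_measure borel \<pi>"
    "transport_cost \<pi> \<le> ennreal (enn2real (wasserstein_norm \<mu>) + e)"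
proof -
  have fin: "wasserstein_norm \<mu> < \<infinity>" by (rule wasserstein_norm_finite[OF assms(1)])
  then obtain \<pi> where "\<pi> \<in> transports \<mu>" "transport_cost \<pi> < wasserstein_norm \<mu> + ennreal e"
    using INF_approx_ennreal[OF assms(2) wasserstein_norm_def[unfolded transport_cost_def[symmetric]], of \<mu>] by (auto simp: less_top)
  moreover have "wasserstein_norm \<mu> + ennreal e = ennreal (enn2real (wasserstein_norm \<mu>) + e)"
    using fin assms(2) by (simp add: ennreal_plus)
  ultimately show thesis by (intro that[of \<pi>]) (auto simp: transports_def)
qed

lemma enn2real_wasserstein_norm_le:
  assumes "\<pi> \<in> transports \<mu>" "transport_cost \<pi> \<le> ennreal a" "a \<ge> 0"
  shows "enn2real (wasserstein_norm \<mu>) \<le> a"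
  using order_trans[OF wasserstein_norm_le[OF assms(1)] assms(2)] assms(3) by (simp add: enn2real_leI)

lemma wasserstein_norm_add_le:
  fixes \<mu> \<nu> :: "'a::{metric_space, second_countable_topology} set \<Rightarrow> real ^ 'm"
  assumes \<mu>: "\<mu> \<in> wasserstein_space" and \<nu>: "\<nu> \<in> wasserstein_space"
  shows "enn2real (wasserstein_norm (\<mu> + \<nu>)) \<le> enn2real (wasserstein_norm \<mu>) + enn2real (wasserstein_norm \<nu>)"
proof (rule field_le_epsilon)
  fix e :: real assume e: "e > 0"
  obtain \<pi> where \<pi>: "\<pi> \<in> transports \<mu>" "vector_measure borel \<pi>"
    "transport_cost \<pi> \<le> ennreal (enn2real (wasserstein_norm \<mu>) + e / 2)"
    using wasserstein_norm_approx[OF \<mu>, of "e / 2"] e by auto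
  obtain \<rho> where \<rho>: "\<rho> \<in> transports \<nu>" "vector_measure borel \<rho>"
    "transport_cost \<rho> \<le> ennreal (enn2real (wasserstein_norm \<nu>) + e / 2)"
    using wasserstein_norm_approx[OF \<nu>, of "e / 2"] e by auto
  show "enn2real (wasserstein_norm (\<mu> + \<nu>)) \<le> enn2real (wasserstein_norm \<mu>) + enn2real (wasserstein_norm \<nu>) + e"
  proof (rule enn2real_wasserstein_norm_le)
    show "\<pi> + \<rho> \<in> transports (\<mu> + \<nu>)"
      using \<pi>(1) \<rho>(1) vector_measure_add[OF \<pi>(2) \<rho>(2)]
      by (simp add: transports_def plus_fun_def marginal1_def marginal2_def algebra_simps)
    have "transport_cost (\<pi> + \<rho>) \<le> transport_cost \<pi> + transport_cost \<rho>"
      by (rule transport_cost_add_le[OF \<pi>(2) \<rho>(2)])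
    also have "\<dots> \<le> ennreal (enn2real (wasserstein_norm \<mu>) + e / 2) + ennreal (enn2real (wasserstein_norm \<nu>) + e / 2)"
      by (intro add_mono \<pi>(3) \<rho>(3))
    also have "\<dots> = ennreal (enn2real (wasserstein_norm \<mu>) + enn2real (wasserstein_norm \<nu>) + e)"
      using e by (simp flip: ennreal_plus add: algebra_simps)
    finally show "transport_cost (\<pi> + \<rho>) \<le> ennreal (enn2real (wasserstein_norm \<mu>) + enn2real (wasserstein_norm \<nu>) + e)" .
  qed (use e in simp)
qed

lemma wasserstein_norm_scaleR_le:
  fixes \<mu> :: "'a::{metric_space, second_countable_topology} set \<Rightarrow> real ^ 'm"
  assumes \<mu>: "\<mu> \<in> wasserstein_space" and c: "c > 0"
  shows "enn2real (wasserstein_norm (c *\<^sub>R \<mu>)) \<le> c * enn2real (wasserstein_norm \<mu>)"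
proof (rule field_le_epsilon)
  fix e :: real assume e: "e > 0"
  obtain \<pi> where \<pi>: "\<pi> \<in> transports \<mu>" "vector_measure borel \<pi>"
    "transport_cost \<pi> \<le> ennreal (enn2real (wasserstein_norm \<mu>) + e / c)"
    using wasserstein_norm_approx[OF \<mu>, of "e / c"] e c by auto
  note scale = nn_integral_total_variation_scaleR_le[OF \<pi>(2) borel_measurable_dist_fst_snd, of c,
      folded transport_cost_def]
  show "enn2real (wasserstein_norm (c *\<^sub>R \<mu>)) \<le> c * enn2real (wasserstein_norm \<mu>) + e"
  proof (rule enn2real_wasserstein_norm_le)
    show "(\<lambda>A. c *\<^sub>R \<pi> A) \<in> transports (c *\<^sub>R \<mu>)"
      using \<pi>(1) vector_measure_scaleR[OF \<pi>(2)]
      by (simp add: transports_def scaleR_fun_def marginal1_def marginal2_def flip: scaleR_diff_right)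
    have "transport_cost (\<lambda>A. c *\<^sub>R \<pi> A) \<le> ennreal c * transport_cost \<pi>" using scale c by simp
    also have "\<dots> \<le> ennreal c * ennreal (enn2real (wasserstein_norm \<mu>) + e / c)"
      by (intro mult_left_mono \<pi>(3)) simp
    also have "\<dots> = ennreal (c * (enn2real (wasserstein_norm \<mu>) + e / c))"
      by (rule ennreal_mult[symmetric]) (use c e in simp_all)
    also have "c * (enn2real (wasserstein_norm \<mu>) + e / c) = c * enn2real (wasserstein_norm \<mu>) + e"
      using c by (simp add: field_simps)
    finally show "transport_cost (\<lambda>A. c *\<^sub>R \<pi> A) \<le> ennreal (c * enn2real (wasserstein_norm \<mu>) + e)" .
  qed (use e c in simp)
qed

section \<open>Dipoles and the optimal dual function\<close>

definition dipole :: "'a \<Rightarrow> 'a \<Rightarrow> 'b::real_normed_vector \<Rightarrow> 'a set \<Rightarrow> 'b" where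
  "dipole x y v = (\<lambda>A. indicator A x *\<^sub>R v - indicator A y *\<^sub>R v)"

lemma dipole_transport:
  fixes v :: "real ^ 'm" and x y :: "'a::{metric_space, second_countable_topology}"
  defines "\<pi> \<equiv> (\<lambda>A. indicator A (x, y) *\<^sub>R v)"
  shows "\<pi> \<in> transports (dipole x y v)" "transport_cost \<pi> \<le> ennreal (norm v * dist x y)"
proof -
  show "\<pi> \<in> transports (dipole x y v)"
    unfolding transports_def \<pi>_def mem_Collect_eq
    by (intro conjI vector_measure_point_mass)
      (auto simp: marginal1_def marginal2_def dipole_def indicator_def)
  show "transport_cost \<pi> \<le> ennreal (norm v * dist x y)"
    using nn_integral_total_variation_point_mass_le[OF borel_measurable_dist_fst_snd, of "(x, y)" v]
    by (simp add: transport_cost_def \<pi>_def ennreal_mult)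
qed

lemma dipole_in_wasserstein_space:
  fixes v :: "real ^ 'm" and x y :: "'a::metric_space"
  shows "dipole x y v \<in> wasserstein_space"
proof -
  have eq: "dipole x y v = (\<lambda>A. indicator A x *\<^sub>R v + indicator A y *\<^sub>R (- v))"
    by (simp add: dipole_def)
  have "(\<integral>\<^sup>+z. ennreal (dist z y) \<partial>total_variation borel (dipole x y v))
      \<le> (\<integral>\<^sup>+z. ennreal (dist z y) \<partial>total_variation borel (\<lambda>A. indicator A x *\<^sub>R v))
        + (\<integral>\<^sup>+z. ennreal (dist z y) \<partial>total_variation borel (\<lambda>A. indicator A y *\<^sub>R (- v)))"
    unfolding eq
    by (rule nn_integral_le_add_measure) (simp_all del: scaleR_minus_right add: total_variation_add_le vector_measure_point_mass)
  also have "\<dots> \<le> ennreal (norm v) * ennreal (dist x y) + ennreal (norm (- v)) * ennreal (dist y y)"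
    by (intro add_mono nn_integral_total_variation_point_mass_le borel_measurable_dist_point) simp_all
  also have "\<dots> < \<infinity>" by (simp add: ennreal_mult_less_top)
  finally have "(\<integral>\<^sup>+z. ennreal (dist z y) \<partial>total_variation borel (dipole x y v)) < \<infinity>" .
  moreover have "vector_measure borel (dipole x y v)"
    unfolding eq by (intro vector_measure_add vector_measure_point_mass)
  moreover have "dipole x y v UNIV = 0" by (simp add: dipole_def)
  ultimately show ?thesis by (auto simp: wasserstein_space_def)
qed

lemma sum_fun_apply: "(\<Sum>i\<in>I. F i) x = (\<Sum>i\<in>I. F i x)"
  by (induction I rule: infinite_finite_induct) simp_all

text \<open>
  The image of \<open>\<mu>\<close> under a map with finite range is a finite sum of point masses \<open>\<mu> (T -` {y})\<close> at \<open>y\<close>.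
  Their sum is the total mass zero, so that each of them may be balanced by an opposite mass at the
  base point. The equation holds on all sets, not only on measurable ones: each preimage
  under \<open>T\<close> is a finite union of measurable fibres. This makes it an equation in the vector space of set
  functions.
\<close>

lemma push_forward_simple_eq_sum_dipoles:
  fixes \<mu> :: "'a set \<Rightarrow> 'b::real_normed_vector"
  assumes vm: "vector_measure M \<mu>" and zero: "\<mu> UNIV = 0" and T: "simple_function M T"
    and space: "space M = UNIV"
  shows "(\<lambda>A. \<mu> (T -` A)) = (\<Sum>y\<in>range T. dipole y x0 (\<mu> (T -` {y})))"
proof
  fix A
  have fin: "finite (range T)" and sets: "T -` {y} \<in> sets M" for y
    using simple_functionD[OF T] space by auto
  have add: "\<mu> (T -` B) = (\<Sum>y\<in>range T \<inter> B. \<mu> (T -` {y}))" for B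
  proof -
    have "T -` B = (\<Union>y\<in>range T \<inter> B. T -` {y})" by auto
    then show ?thesis
      using fin sets vector_measure_finite_UN[OF vm, of "range T \<inter> B" "\<lambda>y. T -` {y}"]
      by (auto simp: disjoint_family_on_def)
  qed
  have "(\<Sum>y\<in>range T. dipole y x0 (\<mu> (T -` {y}))) A
      = (\<Sum>y\<in>range T. indicator A y *\<^sub>R \<mu> (T -` {y})) - indicator A x0 *\<^sub>R (\<Sum>y\<in>range T. \<mu> (T -` {y}))"
    by (simp add: sum_fun_apply dipole_def sum_subtractf scaleR_right.sum)
  also have "(\<Sum>y\<in>range T. \<mu> (T -` {y})) = 0" using add[of UNIV] zero by simp
  also have "(\<Sum>y\<in>range T. indicator A y *\<^sub>R \<mu> (T -` {y})) = \<mu> (T -` A)"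
    unfolding add[of A] sum.inter_restrict[OF fin] by (intro sum.cong) (simp_all add: indicator_def)
  finally show "\<mu> (T -` A) = (\<Sum>y\<in>range T. dipole y x0 (\<mu> (T -` {y}))) A" by simp
qed

text \<open>
  Hahn-Banach gives a linear \<open>\<phi>\<close> below the Wasserstein seminorm that agrees with it at \<open>\<mu>\<close>. Its
  values on the dipoles between \<open>x\<close> and a base point are linear in the moment \<open>v\<close> and define a vector
  \<open>u x\<close> by \<open>\<phi> (dipole x x0 v) = \<langle>u x, v\<rangle>\<close>. The function \<open>u\<close> is 1-Lipschitz because
  the dipole between \<open>x\<close> and \<open>y\<close> with moment \<open>v\<close> has norm at most \<open>\<parallel>v\<parallel> * dist x y\<close>.
  For simple maps \<open>T n\<close> that converge to the identity, \<open>\<phi>\<close> of the image measure is by linearity the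
  integral of \<open>\<langle>u \<circ> T n, d\<mu>\<rangle>\<close>, and the image measure is close to \<open>\<mu>\<close> in the Wasserstein norm. In the limit
  the integral of \<open>\<langle>u, d\<mu>\<rangle>\<close> is at least \<open>\<phi> \<mu>\<close>.
\<close>

lemma dual_attained:
  fixes \<mu> :: "'a::{metric_space, second_countable_topology} set \<Rightarrow> real ^ 'm"
  assumes \<mu>: "\<mu> \<in> wasserstein_space"
  obtains u where "1-lipschitz_on UNIV u" "enn2real (wasserstein_norm \<mu>) \<le> inner_integral borel \<mu> u"
proof -
  have vm: "vector_measure borel \<mu>" and zero: "\<mu> UNIV = 0" using \<mu> by (auto simp: wasserstein_space_def)
  define p where "p \<nu> = enn2real (wasserstein_norm \<nu>)" for \<nu> :: "'a set \<Rightarrow> real ^ 'm"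
  obtain \<phi> where \<phi>: "linear \<phi>" "\<And>\<nu>. \<nu> \<in> wasserstein_space \<Longrightarrow> \<phi> \<nu> \<le> p \<nu>" "\<phi> \<mu> = p \<mu>"
    using Hahn_Banach_subspace[OF subspace_wasserstein_space \<mu>, of p]
      wasserstein_norm_add_le wasserstein_norm_scaleR_le unfolding p_def by blast
  define x0 :: 'a where "x0 = undefined"
  define u where "u x = adjoint (\<lambda>v. \<phi> (dipole x x0 v)) 1" for x
  have lin: "linear (\<lambda>v. \<phi> (dipole x x0 v))" for x
  proof -
    have "linear (dipole x x0 :: real ^ 'm \<Rightarrow> _)"
      by (rule linearI) (auto simp: dipole_def fun_eq_iff plus_fun_def scaleR_fun_def algebra_simps)
    from linear_compose[OF this \<phi>(1)] show ?thesis by (simp add: comp_def)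
  qed
  have u: "\<phi> (dipole x x0 v) = u x \<bullet> v" for x v
    using adjoint_works[OF lin, of v x 1] by (simp add: u_def inner_commute)
  have lip: "1-lipschitz_on UNIV u"
  proof (rule lipschitz_onI)
    fix x y
    \<comment> \<open>Testing with the dipole in the direction of the increment gives its squared norm.\<close>
    define w where "w = u x - u y"
    have "dipole x x0 w - dipole y x0 w = dipole x y w" by (simp add: fun_eq_iff dipole_def)
    then have "w \<bullet> w = \<phi> (dipole x y w)"
      using linear_diff[OF \<phi>(1), of "dipole x x0 w" "dipole y x0 w"] by (simp add: u w_def inner_diff_left)
    also have "\<dots> \<le> p (dipole x y w)" by (intro \<phi>(2) dipole_in_wasserstein_space)
    also have "\<dots> \<le> norm w * dist x y"
      unfolding p_def by (rule enn2real_wasserstein_norm_le[OF dipole_transport]) simp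
    finally have "norm w * norm w \<le> norm w * dist x y" by (simp add: power2_norm_eq_inner flip: power2_eq_square)
    then show "dist (u x) (u y) \<le> 1 * dist x y"
      by (cases "w = 0") (auto simp: w_def dist_norm)
  qed simp
  note u_int = lipschitz_integrable[OF \<mu> lip]
  \<comment> \<open>Separability enters here: the identity is a limit of simple functions, dominated by the moment.\<close>
  obtain T where T: "\<And>n. simple_function borel (T n)" "\<And>x. (\<lambda>n. T n x) \<longlonglongrightarrow> x"
      "\<And>n x. dist (T n x) x0 \<le> 2 * dist x x0"
    using borel_measurable_implies_sequence_metric[of "\<lambda>x::'a. x" borel x0] by simp metis
  have T_meas: "T n \<in> borel_measurable borel" for n by (rule borel_measurable_simple_function[OF T(1)])
  note dist_int = wasserstein_space_integrable_dist[OF \<mu>]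
  have dist_T: "dist x (T n x) \<le> 3 * dist x x0" for n x
    using dist_triangle2[of x "T n x" x0] T(3)[of n x] by simp
  have meas_dist: "(\<lambda>x. dist x (T n x)) \<in> borel_measurable borel" for n
    by (intro borel_measurable_dist T_meas) simp
  have le: "\<phi> \<mu> \<le> inner_integral borel \<mu> (\<lambda>x. u (T n x)) + (\<integral>x. dist x (T n x) \<partial>total_variation borel \<mu>)" for n
  proof -
    define \<nu> where "\<nu> = (\<lambda>A. \<mu> (T n -` A))"
    have \<nu>_eq: "\<nu> = (\<Sum>y\<in>range (T n). dipole y x0 (\<mu> (T n -` {y})))"
      unfolding \<nu>_def by (rule push_forward_simple_eq_sum_dipoles[OF vm zero T(1)]) simp
    have \<nu>: "\<nu> \<in> wasserstein_space"
      unfolding \<nu>_eq by (intro subspace_sum subspace_wasserstein_space dipole_in_wasserstein_space)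
    have "\<phi> \<nu> = (\<Sum>y\<in>range (T n). u y \<bullet> \<mu> (T n -` {y}))"
      by (simp add: \<nu>_eq linear_sum[OF \<phi>(1)] u)
    also have "\<dots> = inner_integral borel \<mu> (\<lambda>x. u (T n x))"
      using inner_integral_simple[OF vm T(1), of u n] by simp
    finally have \<phi>\<nu>: "\<phi> \<nu> = inner_integral borel \<mu> (\<lambda>x. u (T n x))" .
    have int: "integrable (total_variation borel \<mu>) (\<lambda>x. dist x (T n x))"
      by (rule Bochner_Integration.integrable_bound[OF integrable_mult_right[OF dist_int, of 3 x0]])
        (use dist_T meas_dist in simp_all)
    have "\<phi> \<mu> - \<phi> \<nu> = \<phi> (\<mu> - \<nu>)" by (simp add: linear_diff[OF \<phi>(1)])
    also have "\<dots> \<le> p (\<mu> - \<nu>)" by (intro \<phi>(2) subspace_diff subspace_wasserstein_space \<mu> \<nu>)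
    also have "\<dots> \<le> (\<integral>x. dist x (T n x) \<partial>total_variation borel \<mu>)"
      unfolding p_def
    proof (rule enn2real_wasserstein_norm_le)
      show "(\<lambda>A. \<mu> ((\<lambda>x. (x, T n x)) -` A)) \<in> transports (\<mu> - \<nu>)"
        using map_transport(1-3)[OF vm T_meas, of n] by (simp add: transports_def \<nu>_def)
      show "transport_cost (\<lambda>A. \<mu> ((\<lambda>x. (x, T n x)) -` A)) \<le> ennreal (\<integral>x. dist x (T n x) \<partial>total_variation borel \<mu>)"
        using map_transport(4)[OF vm T_meas, of n] nn_integral_eq_integral[OF int] by simp
    qed simp
    finally show ?thesis using \<phi>\<nu> by simp
  qed
  have "(\<lambda>n. inner_integral borel \<mu> (\<lambda>x. u (T n x))) \<longlonglongrightarrow> inner_integral borel \<mu> u"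
  proof (rule inner_integral_dominated_convergence[OF vm u_int(1)])
    interpret finite_measure "total_variation borel \<mu>" by (rule finite_measure_total_variation[OF vm])
    show "integrable (total_variation borel \<mu>) (\<lambda>x. norm (u x0) + 2 * dist x x0)"
      by (intro Bochner_Integration.integrable_add integrable_mult_right dist_int) simp
    show "(\<lambda>x. u (T n x)) \<in> borel_measurable borel" for n
      by (rule measurable_compose[OF T_meas u_int(1)])
    show "(\<lambda>n. u (T n x)) \<longlonglongrightarrow> u x" for x
      using continuous_on_tendsto_compose[OF lipschitz_on_continuous_on[OF lip] T(2)] by simp
    show "norm (u (T n x)) \<le> norm (u x0) + 2 * dist x x0" for n x
      using norm_triangle_sub[of "u (T n x)" "u x0"] lipschitz_onD[OF lip, of "T n x" x0] T(3)[of n x]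
      by (simp add: dist_norm)
  qed
  moreover have "(\<lambda>n. \<integral>x. dist x (T n x) \<partial>total_variation borel \<mu>) \<longlonglongrightarrow> (\<integral>x. 0 \<partial>total_variation borel \<mu>)"
  proof (rule integral_dominated_convergence[where w = "\<lambda>x. 3 * dist x x0"])
    have "(\<lambda>n. dist x (T n x)) \<longlonglongrightarrow> 0" for x
      using tendsto_dist[OF tendsto_const T(2), of x x] by simp
    then show "AE x in total_variation borel \<mu>. (\<lambda>n. dist x (T n x)) \<longlonglongrightarrow> 0" by simp
  qed (use dist_T meas_dist dist_int in simp_all)
  ultimately have "(\<lambda>n. inner_integral borel \<mu> (\<lambda>x. u (T n x)) + (\<integral>x. dist x (T n x) \<partial>total_variation borel \<mu>))
      \<longlonglongrightarrow> inner_integral borel \<mu> u + 0" using tendsto_add by fastforce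
  then have "\<phi> \<mu> \<le> inner_integral borel \<mu> u" using le by (intro LIMSEQ_le_const[rotated]) auto
  then show thesis using that[OF lip] \<phi>(3) by (simp add: p_def)
qed

theorem theorem2:
  fixes \<mu> :: "'a::{metric_space, second_countable_topology} set \<Rightarrow> real ^ 'm"
  assumes "completely_metrizable_space (euclidean :: 'a topology)"
    and "\<mu> \<in> wasserstein_space"
  shows "(SUP u \<in> {u :: 'a \<Rightarrow> real ^ 'm. 1-lipschitz_on UNIV u}. ereal (inner_integral borel \<mu> u)) =
           enn2ereal (wasserstein_norm \<mu>) \<and>
         (\<exists>u0 :: 'a \<Rightarrow> real ^ 'm. 1-lipschitz_on UNIV u0 \<and>
           (SUP u \<in> {u :: 'a \<Rightarrow> real ^ 'm. 1-lipschitz_on UNIV u}. ereal (inner_integral borel \<mu> u)) =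
             ereal (inner_integral borel \<mu> u0))"
proof -
  have norm: "enn2ereal (wasserstein_norm \<mu>) = ereal (enn2real (wasserstein_norm \<mu>))"
    using wasserstein_norm_finite[OF assms(2)] by (cases "wasserstein_norm \<mu>") simp_all
  have weak: "inner_integral borel \<mu> u \<le> enn2real (wasserstein_norm \<mu>)"
    if u: "1-lipschitz_on UNIV u" for u :: "'a \<Rightarrow> real ^ 'm"
  proof -
    have "ennreal (inner_integral borel \<mu> u) \<le> wasserstein_norm \<mu>"
      unfolding wasserstein_norm_def
      using weak_duality[OF assms(2) _ u] by (intro INF_greatest) (simp add: transport_cost_def)
    then show ?thesis using wasserstein_norm_finite[OF assms(2)]
      by (cases "wasserstein_norm \<mu>") (auto simp: ennreal_le_iff2)
  qed
  obtain u0 where u0: "1-lipschitz_on UNIV u0" "enn2real (wasserstein_norm \<mu>) \<le> inner_integral borel \<mu> u0"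
    using dual_attained[OF assms(2)] by blast
  have eq: "inner_integral borel \<mu> u0 = enn2real (wasserstein_norm \<mu>)"
    using u0(2) weak[OF u0(1)] by simp
  have "(SUP u \<in> {u :: 'a \<Rightarrow> real ^ 'm. 1-lipschitz_on UNIV u}. ereal (inner_integral borel \<mu> u))
      = ereal (inner_integral borel \<mu> u0)"
    by (rule antisym; rule SUP_least SUP_upper) (use weak u0(1) eq in auto)
  then show ?thesis using norm eq u0(1) by auto
qed

end
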